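(* In the setting described in the context (polyhedral feasible set $\mathcal D_P$, $f$ continuously differentiable and $L$-relatively smooth with respect to the Shannon entropy on $\mathcal D_P$, and $\{x^k\}_{k\ge 0}$ a BPGM sequence with $x^0\in\mathcal D_P\cap\mathbb R^n_{++}$ and step sizes $\alpha_k\in[\underline\alpha,\bar\alpha]$, $0<\underline\alpha<\bar\alpha<1/L$), suppose further that $F=f+\delta_{\mathcal D_P}$ is an SKŁ function with exponent $1/2$ and that the sequence $\{x^k\}_{k\ge0}$ is bounded. Then $\{x^k\}_{k\ge 0}$ converges R-linearly to a critical point $x^*$ of $F$, and $\{F(x^k)\}_{k\ge0}$ converges Q-linearly to $F(x^* )$.
   Context: Setting. $A\in\mathbb R^{m\times n}$ has full row rank, $b\in\mathbb R^m$, $\mathcal D_P=\{x\in\mathbb R^n: Ax=b,\ x\ge 0\}$, and $\mathcal D_P\cap\mathbb R^n_{++}\neq\emptyset$. $h_S(x)=\sum_{i=1}^n x_i\log x_i$ on $\mathbb R^n_+$ (with $0\log 0=0$). The function $f:\mathbb R^n\to\mathbb R$ is continuously differentiable (not necessarily convex) and $L$-relatively smooth with respect to $h_S$ on $\mathcal D_P$ for some $L>0$, i.e. $Lh_S-f$ is convex on $\mathcal D_P$. The problem $\min_{x\in\mathcal D_P} f(x)$ is assumed to have an optimal solution. $F=f+\delta_{\mathcal D_P}$, where $\delta_{\mathcal D_P}$ is $0$ on $\mathcal D_P$ and $+\infty$ elsewhere. BPGM. For $x\in\mathbb R^n_+$, $y\in\mathbb R^n_{++}$, $D_{h_S}(x,y)=h_S(x)-h_S(y)-\nabla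 h_S(y)^\top(x-y)$. A BPGM sequence starts at $x^0\in\mathcal D_P\cap\mathbb R^n_{++}$ and satisfies, for $k\ge0$, $x^{k+1}=\operatorname{argmin}_{x\in\mathcal D_P}\{f(x^k)+\nabla f(x^k)^\top(x-x^k)+\frac1{\alpha_k}D_{h_S}(x,x^k)\}$. Equivalently, with $\exp$ entrywise, $x^{k+1}=\operatorname{Diag}(\exp(-\alpha_k(\nabla f(x^k)+A^\top\mu^k)))x^k\in\mathcal D_P\cap\mathbb R^n_{++}$, where $\mu^k=\operatorname{argmin}_{\mu\in\mathbb R^m}\{\frac1{\alpha_k}\exp(-\alpha_k(\nabla f(x^k)+A^\top\mu))^\top x^k+b^\top\mu\}$. Subdifferential. For proper $g:\mathbb R^n\to\mathbb R\cup\{+\infty\}$ and $x\in\operatorname{dom}(g)$, $\widehat\partial g(x)$ is the set of $v$ with $\liminf_{y\to x,\,y\ne x}\frac{g(y)-g(x)-\langle v,y-x\rangle}{\|y-x\|_2}\ge0$, and $\partial g(x)$ is the set of limits of $v^k\in\widehat\partial g(x^k)$ with $x^k\to x$, $g(x^k)\to g(x)$. A function defined on $\mathbb R^n_+$ is extended by $+\infty$ outside. $\operatorname{dom}(\partial g)=\{x:\partial g(x)\ne\emptyset\}$. For $x\in\mathcal D_P$, $\partial F(x)=\{\nabla f(x)+A^\top\mu-\lambda:\mu\in\mathbb R^m,\ \lambda\ge0,\ \lambda^\top x=0\}$. A critical point of a function $H$ is a point $\bar x$ with $0\in\partial H(\bar x)$. SKŁ property. A function $H:\mathbb R^n_+\to\mathbb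 R\cup\{+\infty\}$ has the SKŁ property at $x^*\in\operatorname{dom}(\partial H)$ if there exist $\eta\in(0,+\infty]$, a neighborhood $\mathcal U$ of $x^*$, and a continuous concave $\varphi:[0,\eta)\to\mathbb R_+$ with $\varphi(0)=0$, continuously differentiable on $(0,\eta)$ with $\varphi'>0$ there, such that for all $x\in\mathcal U$ with $H(x^* )<H(x)<H(x^* )+\eta$: $\varphi'(H(x)-H(x^* ))\cdot\operatorname{dist}(0,\operatorname{Diag}(\sqrt x)\,\partial H(x))\ge1$. Here $\sqrt x$ is entrywise, $\operatorname{dist}$ is Euclidean, and $\operatorname{dist}(0,\emptyset)=+\infty$. If one can take $\varphi(s)=\tilde c\,s^{1-\alpha}$ with $\tilde c>0$, $\alpha\in[0,1)$, then $H$ has the SKŁ property at $x^*$ with exponent $\alpha$. $H$ is an SKŁ function if it has the SKŁ property at every $x^*\in\operatorname{dom}(\partial H)$; it is an SKŁ function with exponent $\alpha$ if moreover it has the SKŁ property with exponent $\alpha$ at every critical point. $F$ is regarded as a function on $\mathbb R^n_+$ by restriction. Rates. A sequence $\{w^k\}$ (of vectors or scalars) converges Q-linearly to $w^*$ if there are $\gamma\in(0,1)$ and $K\ge0$ with $\|w^{k+1}-w^*\|_2\le\gamma\|w^k-w^*\|_2$ for all $k\ge K$; it converges R-linearly to $w^*$ if there are $\gamma\in(0,1)$, $\Theta>0$ with $\|w^k-w^*\|_2\le\Theta\gamma^k$ for all $k\ge0$. *)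

theory Defs
  imports "HOL-Analysis.Analysis"
begin

section \<open>Entropy and the BPGM iteration\<close>

definition nonneg_orthant :: "(real ^ 'n) set" where
  "nonneg_orthant = {x. \<forall>i. 0 \<le> x $ i}"

definition pos_orthant :: "(real ^ 'n) set" where
  "pos_orthant = {x. \<forall>i. 0 < x $ i}"

definition feasible_set :: "real ^ 'n ^ 'm \<Rightarrow> real ^ 'm \<Rightarrow> (real ^ 'n) set" where
  "feasible_set A b = {x. A *v x = b} \<inter> nonneg_orthant"

text \<open>The convention \<open>0 log 0 = 0\<close> holds because of the factor \<open>0\<close>.\<close>

definition shannon :: "real ^ 'n \<Rightarrow> real" where
  "shannon x = (\<Sum>i\<in>UNIV. x $ i * ln (x $ i))"

definition grad_shannon :: "real ^ 'n \<Rightarrow> real ^ 'n" where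
  "grad_shannon y = (\<chi> i. ln (y $ i) + 1)"

lemma GDERIV_shannon:
  assumes "y \<in> pos_orthant"
  shows "GDERIV shannon y :> grad_shannon y"
proof -
  have pos: "0 < y $ i" for i
    using assms by (simp add: pos_orthant_def)
  have 1: "((\<lambda>x. x $ i * ln (x $ i)) has_derivative (\<lambda>h. h $ i * (ln (y $ i) + 1))) (at y)" for i
    using pos[of i]
    by (auto intro!: derivative_eq_intros bounded_linear.has_derivative[OF bounded_linear_vec_nth]
        simp: field_simps)
  have "((\<lambda>x. \<Sum>i\<in>UNIV. x $ i * ln (x $ i)) has_derivative
         (\<lambda>h. \<Sum>i\<in>UNIV. h $ i * (ln (y $ i) + 1))) (at y)"
    by (intro has_derivative_sum 1)
  then show ?thesis
    by (simp add: gderiv_def shannon_def[abs_def] grad_shannon_def inner_vec_def)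
qed

text \<open>The Bregman distance is meant for \<open>x\<close> in the nonnegative and \<open>y\<close> in the positive orthant.\<close>

definition bregman_shannon :: "real ^ 'n \<Rightarrow> real ^ 'n \<Rightarrow> real" where
  "bregman_shannon x y = shannon x - shannon y - grad_shannon y \<bullet> (x - y)"

text \<open>
  Here \<open>g\<close> is the gradient of \<open>f\<close> and \<open>D\<close> the feasible set. Positivity of the later iterates
  is not required; it follows from positivity of \<open>x 0\<close>.
\<close>

definition bpgm_sequence ::
  "(real ^ 'n) set \<Rightarrow> (real ^ 'n \<Rightarrow> real) \<Rightarrow> (real ^ 'n \<Rightarrow> real ^ 'n) \<Rightarrow>
   (nat \<Rightarrow> real) \<Rightarrow> (nat \<Rightarrow> real ^ 'n) \<Rightarrow> bool" where
  "bpgm_sequence D f g \<alpha> x \<longleftrightarrow>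
     x 0 \<in> D \<inter> pos_orthant \<and>
     (\<forall>k. is_arg_min
            (\<lambda>y. f (x k) + g (x k) \<bullet> (y - x k) + 1 / \<alpha> k * bregman_shannon y (x k))
            (\<lambda>y. y \<in> D) (x (Suc k)))"

definition relatively_smooth_on ::
  "(real ^ 'n) set \<Rightarrow> real \<Rightarrow> (real ^ 'n \<Rightarrow> real) \<Rightarrow> (real ^ 'n \<Rightarrow> real) \<Rightarrow> bool" where
  "relatively_smooth_on D L h f \<longleftrightarrow> convex_on D (\<lambda>x. L * h x - f x)"

section \<open>Extended-real-valued functions and subdifferentials\<close>

definition convex_indicator :: "'a set \<Rightarrow> 'a \<Rightarrow> ereal" where
  "convex_indicator D x = (if x \<in> D then 0 else \<infinity>)"

definition penalized :: "('a \<Rightarrow> real) \<Rightarrow> 'a set \<Rightarrow> 'a \<Rightarrow> ereal" where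
  "penalized f D x = ereal (f x) + convex_indicator D x"

text \<open>Both subdifferentials are empty where the function is not finite.\<close>

definition frechet_subdiff :: "(real ^ 'n \<Rightarrow> ereal) \<Rightarrow> real ^ 'n \<Rightarrow> (real ^ 'n) set" where
  "frechet_subdiff g x =
     {v. \<bar>g x\<bar> \<noteq> \<infinity> \<and>
         0 \<le> Liminf (at x) (\<lambda>y. (g y - g x - ereal (v \<bullet> (y - x))) / ereal (norm (y - x)))}"

definition limiting_subdiff :: "(real ^ 'n \<Rightarrow> ereal) \<Rightarrow> real ^ 'n \<Rightarrow> (real ^ 'n) set" where
  "limiting_subdiff g x =
     {v. \<bar>g x\<bar> \<noteq> \<infinity> \<and>
         (\<exists>xs vs. (\<forall>k. vs k \<in> frechet_subdiff g (xs k)) \<and>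
                  xs \<longlonglongrightarrow> x \<and> (\<lambda>k. g (xs k)) \<longlonglongrightarrow> g x \<and> vs \<longlonglongrightarrow> v)}"

definition dom_subdiff :: "(real ^ 'n \<Rightarrow> ereal) \<Rightarrow> (real ^ 'n) set" where
  "dom_subdiff g = {x. limiting_subdiff g x \<noteq> {}}"

definition critical_point :: "(real ^ 'n \<Rightarrow> ereal) \<Rightarrow> real ^ 'n \<Rightarrow> bool" where
  "critical_point g x \<longleftrightarrow> 0 \<in> limiting_subdiff g x"

section \<open>The SKL property\<close>

text \<open>
  The distance from \<open>0\<close> is extended-real-valued so that it is \<open>\<infinity>\<close> for the empty set
  (\<open>infdist\<close> would give \<open>0\<close>).
\<close>

definition dist_zero :: "(real ^ 'n) set \<Rightarrow> ereal" where
  "dist_zero S = (INF v\<in>S. ereal (norm v))"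

definition diag_sqrt :: "real ^ 'n \<Rightarrow> real ^ 'n \<Rightarrow> real ^ 'n" where
  "diag_sqrt x v = (\<chi> i. sqrt (x $ i) * v $ i)"

definition desingularizing :: "ereal \<Rightarrow> (real \<Rightarrow> real) \<Rightarrow> bool" where
  "desingularizing \<eta> \<phi> \<longleftrightarrow>
     continuous_on {s. 0 \<le> s \<and> ereal s < \<eta>} \<phi> \<and>
     concave_on {s. 0 \<le> s \<and> ereal s < \<eta>} \<phi> \<and>
     (\<forall>s. 0 \<le> s \<and> ereal s < \<eta> \<longrightarrow> 0 \<le> \<phi> s) \<and>
     \<phi> 0 = 0 \<and>
     (\<forall>s. 0 < s \<and> ereal s < \<eta> \<longrightarrow> \<phi> differentiable at s \<and> 0 < deriv \<phi> s) \<and>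
     continuous_on {s. 0 < s \<and> ereal s < \<eta>} (deriv \<phi>)"

text \<open>A function on the nonnegative orthant is extended by \<open>\<infinity>\<close>; only its values there matter.\<close>

definition orthant_extension :: "(real ^ 'n \<Rightarrow> ereal) \<Rightarrow> real ^ 'n \<Rightarrow> ereal" where
  "orthant_extension H x = (if x \<in> nonneg_orthant then H x else \<infinity>)"

definition skl_with :: "(real \<Rightarrow> real) \<Rightarrow> (real ^ 'n \<Rightarrow> ereal) \<Rightarrow> real ^ 'n \<Rightarrow> bool" where
  "skl_with \<phi> H xs \<longleftrightarrow>
     xs \<in> dom_subdiff (orthant_extension H) \<and>
     (\<exists>\<eta> U. 0 < \<eta> \<and> open U \<and> xs \<in> U \<and> desingularizing \<eta> \<phi> \<and>
       (\<forall>x\<in>U \<inter> nonneg_orthant. H xs < H x \<and> H x < H xs + \<eta> \<longrightarrow>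
          1 \<le> ereal (deriv \<phi> (real_of_ereal (H x - H xs))) *
              dist_zero (diag_sqrt x ` limiting_subdiff (orthant_extension H) x)))"

definition skl_at :: "(real ^ 'n \<Rightarrow> ereal) \<Rightarrow> real ^ 'n \<Rightarrow> bool" where
  "skl_at H xs \<longleftrightarrow> (\<exists>\<phi>. skl_with \<phi> H xs)"

definition skl_at_exponent :: "real \<Rightarrow> (real ^ 'n \<Rightarrow> ereal) \<Rightarrow> real ^ 'n \<Rightarrow> bool" where
  "skl_at_exponent \<theta> H xs \<longleftrightarrow>
     0 \<le> \<theta> \<and> \<theta> < 1 \<and> (\<exists>c>0. skl_with (\<lambda>s. c * s powr (1 - \<theta>)) H xs)"

definition skl_function :: "(real ^ 'n \<Rightarrow> ereal) \<Rightarrow> bool" where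
  "skl_function H \<longleftrightarrow> (\<forall>xs\<in>dom_subdiff (orthant_extension H). skl_at H xs)"

definition skl_function_exponent :: "real \<Rightarrow> (real ^ 'n \<Rightarrow> ereal) \<Rightarrow> bool" where
  "skl_function_exponent \<theta> H \<longleftrightarrow>
     skl_function H \<and>
     (\<forall>xs. critical_point (orthant_extension H) xs \<longrightarrow> skl_at_exponent \<theta> H xs)"

section \<open>Rates of convergence\<close>

definition Q_linear :: "(nat \<Rightarrow> 'a::real_normed_vector) \<Rightarrow> 'a \<Rightarrow> bool" where
  "Q_linear w l \<longleftrightarrow>
     (\<exists>\<gamma> K. 0 < \<gamma> \<and> \<gamma> < 1 \<and> (\<forall>k\<ge>K. norm (w (Suc k) - l) \<le> \<gamma> * norm (w k - l)))"

definition R_linear :: "(nat \<Rightarrow> 'a::real_normed_vector) \<Rightarrow> 'a \<Rightarrow> bool" where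
  "R_linear w l \<longleftrightarrow>
     (\<exists>\<gamma> \<Theta>. 0 < \<gamma> \<and> \<gamma> < 1 \<and> 0 < \<Theta> \<and> (\<forall>k. norm (w k - l) \<le> \<Theta> * \<gamma> ^ k))"

end

theory Submission imports Defs begin

text \<open>
  Let \<open>t k\<close> be the change of the logarithms in step \<open>k\<close>, that is, the difference of the entropy
  gradients. Optimality of the step puts \<open>\<alpha> k \<nabla>f(x k) + t k\<close> in the orthogonal complement of the
  kernel of \<open>A\<close>, so \<open>- t k / \<alpha> k\<close> is a subgradient of \<open>F\<close> at \<open>x k\<close>. The vectors \<open>t k\<close> are bounded,
  hence with \<open>e k\<close> the norm of \<open>Diag (sqrt (x k)) (t k)\<close>, the decrease of \<open>f\<close> is at least a multiple
  of \<open>(e k)\<^sup>2\<close> and the step length at most a multiple of \<open>e k\<close>. The SKL inequality at \<open>x k\<close> bounds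
  exactly \<open>e k / \<alpha> k\<close> from below, and the usual Kurdyka-Lojasiewicz telescoping with
  \<open>\<phi> (f (x k) - f xs)\<close> gives convergence. The limit is critical because the sums of \<open>t k \<bullet> y\<close>
  telescope to logarithms that are bounded above. Only then does the exponent \<open>1/2\<close> apply at the
  limit: it turns the decrease estimate into a contraction of the function values.
\<close>

section \<open>Tangent inequalities and subgradients\<close>

lemma GDERIV_along_line:
  fixes f :: "'a::real_inner \<Rightarrow> real"
  assumes "GDERIV f (x + s *\<^sub>R d) :> D"
  shows "((\<lambda>s. f (x + s *\<^sub>R d)) has_real_derivative D \<bullet> d) (at s)"
proof -
  have line: "((\<lambda>s. x + s *\<^sub>R d) has_derivative (\<lambda>h. h *\<^sub>R d)) (at s)"
    by (auto intro!: derivative_eq_intros)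
  have "(f has_derivative (\<lambda>h. h \<bullet> D)) (at (x + s *\<^sub>R d))"
    using assms by (simp add: gderiv_def)
  from has_derivative_compose[OF line this]
  have "((\<lambda>s. f (x + s *\<^sub>R d)) has_derivative (\<lambda>h. (h *\<^sub>R d) \<bullet> D)) (at s)" .
  then show ?thesis
    by (simp add: has_field_derivative_def mult_commute_abs inner_commute)
qed

text \<open>By convexity the difference quotients from \<open>x\<close> towards \<open>y\<close>
  stay below \<open>f y - f x\<close>, and they tend to the directional derivative. The limit is
  one-sided because \<open>S\<close>, later the feasible set, may fail to be a neighbourhood of
  \<open>x\<close>.\<close>

lemma convex_on_above_tangent:
  fixes f :: "'a::real_inner \<Rightarrow> real"
  assumes conv: "convex_on S f" and x: "x \<in> S" and y: "y \<in> S" and grad: "GDERIV f x :> d"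
  shows "d \<bullet> (y - x) \<le> f y - f x"
proof -
  let ?u = "\<lambda>s. f (x + s *\<^sub>R (y - x))"
  have "(?u has_real_derivative d \<bullet> (y - x)) (at 0)"
    by (rule GDERIV_along_line) (use grad in simp)
  then have "((\<lambda>s. (?u s - ?u 0) / s) \<longlongrightarrow> d \<bullet> (y - x)) (at 0)"
    by (simp add: DERIV_def)
  then have lim: "((\<lambda>s. (?u s - ?u 0) / s) \<longlongrightarrow> d \<bullet> (y - x)) (at_right 0)"
    using filterlim_at_split by blast
  have "\<forall>\<^sub>F s in at_right 0. (?u s - ?u 0) / s \<le> f y - f x"
    unfolding eventually_at_right_field
  proof (intro exI[of _ 1] conjI allI impI)
    fix s :: real assume s: "0 < s" "s < 1"
    have "x + s *\<^sub>R (y - x) = (1 - s) *\<^sub>R x + s *\<^sub>R y"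
      by (simp add: algebra_simps)
    then have "?u s \<le> (1 - s) * f x + s * f y"
      using convex_onD[OF conv, of s x y] s x y by simp
    then show "(?u s - ?u 0) / s \<le> f y - f x"
      using s by (simp add: field_simps)
  qed simp
  with lim show ?thesis
    by (rule tendsto_upperbound) simp
qed

text \<open>The quotient in the Liminf dominates the first-order remainder quotient of
  \<open>f\<close>, which tends to 0: on \<open>D\<close> by \<open>normal\<close>, off
  \<open>D\<close> because it is infinite there.\<close>

lemma frechet_subdiff_penalizedI:
  assumes grad: "GDERIV f x :> g" and x: "x \<in> D"
    and normal: "\<And>y. y \<in> D \<Longrightarrow> 0 \<le> (g - v) \<bullet> (y - x)"
  shows "v \<in> frechet_subdiff (penalized f D) x"
proof -
  let ?q = "\<lambda>y. (f y - f x - g \<bullet> (y - x)) / norm (y - x)"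
  let ?r = "\<lambda>y. (penalized f D y - penalized f D x - ereal (v \<bullet> (y - x))) / ereal (norm (y - x))"
  have Fx: "penalized f D x = ereal (f x)"
    using x by (simp add: penalized_def convex_indicator_def)
  have "((\<lambda>y. \<bar>?q y\<bar>) \<longlongrightarrow> 0) (at x)"
    using grad by (simp add: gderiv_def has_derivative_iff_norm inner_commute)
  then have "(?q \<longlongrightarrow> 0) (at x)"
    by (rule tendsto_rabs_zero_cancel)
  then have "((\<lambda>y. ereal (?q y)) \<longlongrightarrow> ereal 0) (at x)"
    by (rule tendsto_ereal)
  then have "Liminf (at x) (\<lambda>y. ereal (?q y)) = 0"
    by (simp add: lim_imp_Liminf zero_ereal_def)
  moreover have "Liminf (at x) (\<lambda>y. ereal (?q y)) \<le> Liminf (at x) ?r"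
  proof (rule Liminf_mono)
    have "ereal (?q y) \<le> ?r y" if "y \<noteq> x" for y
    proof (cases "y \<in> D")
      case True
      then have Fy: "penalized f D y = ereal (f y)"
        by (simp add: penalized_def convex_indicator_def)
      have "?q y \<le> (f y - f x - v \<bullet> (y - x)) / norm (y - x)"
        using normal[OF True] by (intro divide_right_mono) (auto simp: inner_diff_left)
      then show ?thesis
        using that by (simp add: Fx Fy)
    next
      case False
      then have "penalized f D y = \<infinity>"
        by (simp add: penalized_def convex_indicator_def)
      then show ?thesis
        using that by (simp add: Fx)
    qed
    then show "\<forall>\<^sub>F y in at x. ereal (?q y) \<le> ?r y"
      by (simp add: eventually_at_filter)
  qed
  ultimately show ?thesis
    by (simp add: frechet_subdiff_def Fx)
qed

lemma frechet_subset_limiting_subdiff: "frechet_subdiff g x \<subseteq> limiting_subdiff g x"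
proof
  fix v assume v: "v \<in> frechet_subdiff g x"
  then have "\<bar>g x\<bar> \<noteq> \<infinity>"
    by (simp add: frechet_subdiff_def)
  with v show "v \<in> limiting_subdiff g x"
    unfolding limiting_subdiff_def
    by (intro CollectI conjI exI[of _ "\<lambda>_. x"] exI[of _ "\<lambda>_. v"]) auto
qed

lemma dist_zero_le: "v \<in> S \<Longrightarrow> dist_zero S \<le> ereal (norm v)"
  unfolding dist_zero_def by (rule INF_lower)

text \<open>
  If \<open>t\<close> is unbounded, a limit \<open>u\<close> of the directions \<open>t / norm t\<close> lies in \<open>V\<close>, yet every nonzero
  \<open>u $ i\<close> shares its sign with \<open>d $ i\<close>, so \<open>u \<bullet> d > 0\<close>. For the iteration, \<open>V\<close> is the
  orthogonal complement of the kernel of \<open>A\<close>, \<open>t\<close> the change of the logarithms and \<open>d\<close> the step.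
\<close>

lemma bounded_if_near_subspace_and_signs_orthogonal:
  fixes V :: "(real ^ 'n) set"
  assumes V: "subspace V"
  obtains T where
    "\<And>t w d. w \<in> V \<Longrightarrow> norm (t - w) \<le> B \<Longrightarrow> (\<And>v. v \<in> V \<Longrightarrow> v \<bullet> d = 0) \<Longrightarrow>
       (\<And>i. sgn (d $ i) = sgn (t $ i)) \<Longrightarrow> norm t \<le> T"
proof -
  let ?P = "\<lambda>t. \<exists>w d. w \<in> V \<and> norm (t - w) \<le> B \<and> (\<forall>v\<in>V. v \<bullet> d = 0) \<and>
    (\<forall>i. sgn (d $ i) = sgn (t $ i))"
  have "\<exists>T. \<forall>t. ?P t \<longrightarrow> norm t \<le> T"
  proof (rule ccontr)
    assume "\<nexists>T. \<forall>t. ?P t \<longrightarrow> norm t \<le> T"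
    then have "\<exists>t. ?P t \<and> real (Suc n) < norm t" for n
      by (meson not_le)
    then obtain t where "\<And>n. ?P (t n)" and large: "\<And>n. real (Suc n) < norm (t n)"
      by metis
    then obtain w d where w: "\<And>n. w n \<in> V" and near: "\<And>n. norm (t n - w n) \<le> B"
      and d: "\<And>n v. v \<in> V \<Longrightarrow> v \<bullet> d n = 0"
      and sgn_d: "\<And>n i. sgn (d n $ i) = sgn (t n $ i)"
      by metis
    have pos: "0 < norm (t n)" for n
      using large[of n] by linarith
    define u where "u n = t n /\<^sub>R norm (t n)" for n
    have norm_u: "norm (u n) = 1" for n
      using pos[of n] by (simp add: u_def)
    then have "u n \<in> sphere 0 1" for n by simp
    then obtain u' r where u': "u' \<in> sphere 0 1" and r: "strict_mono r"
      and lim: "(u \<circ> r) \<longlonglongrightarrow> u'"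
      using compact_sphere[of "0 :: real ^ 'n" 1] unfolding compact_def by metis
    have inv0: "(\<lambda>n. inverse (norm (t n))) \<longlonglongrightarrow> 0"
    proof (rule tendsto_sandwich[OF _ _ tendsto_const LIMSEQ_inverse_real_of_nat])
      have "inverse (norm (t n)) \<le> inverse (real (Suc n))" for n
        using large[of n] by (intro le_imp_inverse_le) auto
      then show "\<forall>\<^sub>F n in sequentially. inverse (norm (t n)) \<le> inverse (real (Suc n))"
        by (rule always_eventually[OF allI])
    qed auto
    \<comment> \<open>The directions \<open>u n\<close> come within \<open>B / norm (t n)\<close> of
      \<open>V\<close>, which is closed, so their limit lies in \<open>V\<close>.\<close>
    have "(\<lambda>n. u n - w n /\<^sub>R norm (t n)) \<longlonglongrightarrow> 0"
    proof (rule Lim_null_comparison)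
      show "(\<lambda>n. B * inverse (norm (t n))) \<longlonglongrightarrow> 0"
        using tendsto_mult_right_zero[OF inv0, of B] by simp
      have "norm (u n - w n /\<^sub>R norm (t n)) = norm (t n - w n) * inverse (norm (t n))" for n
        by (simp add: u_def flip: scaleR_diff_right)
      then show "\<forall>\<^sub>F n in sequentially. norm (u n - w n /\<^sub>R norm (t n)) \<le> B * inverse (norm (t n))"
        using near by (auto intro!: always_eventually mult_right_mono)
    qed
    from LIMSEQ_subseq_LIMSEQ[OF this r] lim
    have "(\<lambda>n. (u \<circ> r) n - ((\<lambda>n. u n - w n /\<^sub>R norm (t n)) \<circ> r) n) \<longlonglongrightarrow> u' - 0"
      by (rule tendsto_diff[rotated])
    then have "(\<lambda>n. w (r n) /\<^sub>R norm (t (r n))) \<longlonglongrightarrow> u'"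
      by (simp add: o_def)
    then have "u' \<in> V"
      by (rule closed_sequentially[OF closed_subspace[OF V], rotated])
         (simp add: w subspace_scale[OF V])
    \<comment> \<open>Zero entries of \<open>u'\<close> contribute nothing to the inner product with
      \<open>d\<close>; nonzero ones eventually fix the sign. As there are finitely many
      coordinates, one \<open>n\<close> serves them all.\<close>
    have "\<forall>\<^sub>F n in sequentially. u' $ i \<noteq> 0 \<longrightarrow> sgn (u (r n) $ i) = sgn (u' $ i)" for i
    proof -
      have lim_i: "(\<lambda>n. u (r n) $ i) \<longlonglongrightarrow> u' $ i"
        using tendsto_vec_nth[OF lim, of i] by (simp add: o_def)
      consider "u' $ i > 0" | "u' $ i < 0" | "u' $ i = 0" by linarith
      then show ?thesis
      proof cases
        case 1
        then show ?thesis
          using order_tendstoD(1)[OF lim_i 1] by (auto elim!: eventually_mono)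
      next
        case 2
        then show ?thesis
          using order_tendstoD(2)[OF lim_i 2] by (auto elim!: eventually_mono)
      qed simp
    qed
    then have "\<forall>\<^sub>F n in sequentially. \<forall>i. u' $ i \<noteq> 0 \<longrightarrow> sgn (u (r n) $ i) = sgn (u' $ i)"
      by (simp add: eventually_all_finite)
    then obtain n where n: "\<And>i. u' $ i \<noteq> 0 \<Longrightarrow> sgn (u (r n) $ i) = sgn (u' $ i)"
      unfolding eventually_sequentially by blast
    have sgn_eq: "sgn (d (r n) $ i) = sgn (u' $ i)" if "u' $ i \<noteq> 0" for i
      using n[OF that] pos[of "r n"] sgn_d[of "r n" i] by (simp add: u_def sgn_mult)
    have term_pos: "0 < u' $ i * d (r n) $ i" if "u' $ i \<noteq> 0" for i
      using sgn_eq[OF that] that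
      by (metis sgn_greater sgn_0_0 zero_less_mult_iff linorder_neqE_linordered_idom)
    have "u' \<noteq> 0" using u' by auto
    then obtain j where "u' $ j \<noteq> 0"
      by (metis vec_eq_iff zero_index)
    then have "0 < (\<Sum>i\<in>UNIV. u' $ i * d (r n) $ i)"
      using term_pos by (intro sum_pos2[of _ j]) (auto, metis less_eq_real_def mult_eq_0_iff)
    then show False
      using d[OF \<open>u' \<in> V\<close>, of "r n"] by (simp add: inner_vec_def)
  qed
  then show thesis
    using that by blast
qed

section \<open>Convergence of sequences from bounds on their steps\<close>

text \<open>The step bound is available only inside the ball, so staying there is part of the
  induction: some index \<open>K\<close> has both its distance to \<open>xs\<close> and its budget
  \<open>p K\<close> small, and the drift after \<open>K\<close> never exceeds
  \<open>p K\<close>.\<close>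

lemma converges_to_cluster_point_if_steps_telescope:
  fixes x :: "nat \<Rightarrow> 'a::real_normed_vector" and p :: "nat \<Rightarrow> real"
  assumes ball: "0 < \<rho>"
    and step: "\<And>k. N \<le> k \<Longrightarrow> x k \<in> ball xs \<rho> \<Longrightarrow> norm (x (Suc k) - x k) \<le> p k - p (Suc k)"
    and p0: "p \<longlonglongrightarrow> 0" and p_nonneg: "\<And>k. N \<le> k \<Longrightarrow> 0 \<le> p k"
    and r: "strict_mono r" and cluster: "(x \<circ> r) \<longlonglongrightarrow> xs"
  shows "x \<longlonglongrightarrow> xs"
proof (rule LIMSEQ_I)
  fix \<epsilon> :: real assume "0 < \<epsilon>"
  define \<delta> where "\<delta> = min \<rho> \<epsilon>"
  have "0 < \<delta>" using ball \<open>0 < \<epsilon>\<close> by (simp add: \<delta>_def)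
  have "(\<lambda>j. norm ((x \<circ> r) j - xs) + (p \<circ> r) j) \<longlonglongrightarrow> 0"
    using tendsto_add[OF tendsto_norm[OF LIM_zero[OF cluster]] LIMSEQ_subseq_LIMSEQ[OF p0 r]]
    by simp
  from order_tendstoD(2)[OF this \<open>0 < \<delta>\<close>]
  have "\<forall>\<^sub>F j in sequentially. norm (x (r j) - xs) + p (r j) < \<delta> \<and> N \<le> j"
    using eventually_ge_at_top[of N] by eventually_elim simp
  then obtain j where j: "norm (x (r j) - xs) + p (r j) < \<delta>" "N \<le> j"
    unfolding eventually_sequentially by blast
  define K where "K = r j"
  have K: "norm (x K - xs) + p K < \<delta>" "N \<le> K"
    using j seq_suble[OF r, of j] by (auto simp: K_def)
  have drift: "norm (x k - x K) \<le> p K - p k" if "K \<le> k" for k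
    using that
  proof (induction k rule: dec_induct)
    case (step k)
    have "norm (x k - xs) \<le> norm (x k - x K) + norm (x K - xs)"
      using norm_triangle_ineq[of "x k - x K" "x K - xs"] by simp
    also have "\<dots> < \<rho>"
      using step.IH K p_nonneg[of k] step.hyps by (auto simp: \<delta>_def)
    finally have "x k \<in> ball xs \<rho>"
      by (simp add: dist_norm norm_minus_commute)
    then have "norm (x (Suc k) - x k) \<le> p k - p (Suc k)"
      using assms(2)[of k] K step.hyps by simp
    then show ?case
      using step.IH norm_triangle_ineq[of "x (Suc k) - x k" "x k - x K"] by simp
  qed simp
  have "norm (x k - xs) < \<epsilon>" if "K \<le> k" for k
  proof -
    have "norm (x k - xs) \<le> norm (x k - x K) + norm (x K - xs)"
      using norm_triangle_ineq[of "x k - x K" "x K - xs"] by simp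
    also have "\<dots> < \<epsilon>"
      using drift[OF that] K p_nonneg[of k] that by (auto simp: \<delta>_def)
    finally show ?thesis .
  qed
  then show "\<exists>K. \<forall>k\<ge>K. norm (x k - xs) < \<epsilon>" by blast
qed

text \<open>The distance to the limit is at most the sum of all remaining steps, a geometric tail;
  the finitely many indices before \<open>N\<close> only enlarge the constant.\<close>

lemma R_linear_if_geometric_steps:
  fixes x :: "nat \<Rightarrow> 'a::real_normed_vector"
  assumes lim: "x \<longlonglongrightarrow> xs" and q: "0 < q" "q < 1" and C: "0 \<le> C"
    and step: "\<And>k. N \<le> k \<Longrightarrow> norm (x (Suc k) - x k) \<le> C * q ^ k"
  shows "R_linear x xs"
proof -
  have bound: "norm (x k - xs) \<le> C / (1 - q) * q ^ k" if k: "N \<le> k" for k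
  proof -
    have partial: "norm (x m - x k) \<le> C / (1 - q) * (q ^ k - q ^ m)" if "k \<le> m" for m
      using that
    proof (induction m rule: dec_induct)
      case (step m)
      have "norm (x (Suc m) - x k) \<le> norm (x (Suc m) - x m) + norm (x m - x k)"
        using norm_triangle_ineq[of "x (Suc m) - x m" "x m - x k"] by simp
      also have "\<dots> \<le> C * q ^ m + C / (1 - q) * (q ^ k - q ^ m)"
        using assms(5)[of m] step k by (intro add_mono) auto
      also have "\<dots> = C / (1 - q) * (q ^ k - q ^ Suc m)"
        using q by (simp add: field_simps)
      finally show ?case .
    qed simp
    have "(\<lambda>m. norm (x m - x k)) \<longlonglongrightarrow> norm (xs - x k)"
      by (intro tendsto_intros lim)
    moreover have "\<forall>\<^sub>F m in sequentially. norm (x m - x k) \<le> C / (1 - q) * q ^ k"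
      using eventually_ge_at_top[of k]
    proof eventually_elim
      case (elim m)
      have "C / (1 - q) * (q ^ k - q ^ m) \<le> C / (1 - q) * q ^ k"
        using C q by (intro mult_left_mono) auto
      with partial[OF elim] show ?case by simp
    qed
    ultimately have "norm (xs - x k) \<le> C / (1 - q) * q ^ k"
      by (rule tendsto_upperbound) simp
    then show ?thesis by (simp add: norm_minus_commute)
  qed
  define M where "M = Max ((\<lambda>k. norm (x k - xs) / q ^ k) ` {..N})"
  define \<Theta> where "\<Theta> = max 1 (max M (C / (1 - q)))"
  have "norm (x k - xs) \<le> \<Theta> * q ^ k" for k
  proof (cases "N \<le> k")
    case True
    have "C / (1 - q) * q ^ k \<le> \<Theta> * q ^ k"
      using q by (intro mult_right_mono) (auto simp: \<Theta>_def)
    with bound[OF True] show ?thesis by simp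
  next
    case False
    then have "norm (x k - xs) / q ^ k \<le> M"
      unfolding M_def by (intro Max_ge) auto
    then have "norm (x k - xs) / q ^ k \<le> \<Theta>"
      by (simp add: \<Theta>_def)
    then show ?thesis
      using q by (simp add: field_simps)
  qed
  moreover have "0 < \<Theta>" by (simp add: \<Theta>_def)
  ultimately show ?thesis
    unfolding R_linear_def using q by blast
qed


section \<open>The entropy and the minimization problem of a single step\<close>

text \<open>The left side is the tangent of \<open>a * ln a\<close> at \<open>p\<close>. After
  division by \<open>a\<close>, the claim is \<open>ln r \<le> r - 1\<close> for
  \<open>r = p / a\<close>.\<close>

lemma entropy_above_tangent:
  fixes a p :: real
  assumes "0 \<le> a" "0 < p"
  shows "a * ln p + a - p \<le> a * ln a"
proof (cases "a = 0")
  case False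
  then have a: "0 < a" using assms by simp
  have "ln (p / a) \<le> p / a - 1"
    using a assms by (intro ln_le_minus_one) simp
  then have "a * (ln p - ln a) \<le> a * (p / a - 1)"
    using a assms by (intro mult_left_mono) (auto simp: ln_div)
  also have "\<dots> = p - a" using a by (simp add: field_simps)
  finally show ?thesis by (simp add: algebra_simps)
qed (use assms in simp)

text \<open>Coordinates where \<open>z\<close> vanishes satisfy an exact identity, because
  \<open>ln (s * x $ i)\<close> splits and releases the term with \<open>ln s\<close>. All others
  obey plain convexity.\<close>

lemma shannon_at_boundary:
  fixes z x :: "real ^ 'n"
  assumes z: "z \<in> nonneg_orthant" and x: "x \<in> pos_orthant" and s: "0 < s" "s \<le> 1"
  shows "shannon (z + s *\<^sub>R (x - z)) \<le>
    shannon z + s * (shannon x - shannon z) + s * ln s * (\<Sum>i | z $ i = 0. x $ i)"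
proof -
  have z_i: "0 \<le> z $ i" and x_i: "0 < x $ i" for i
    using z x by (auto simp: nonneg_orthant_def pos_orthant_def)
  let ?\<eta> = "\<lambda>a :: real. a * ln a"
  have "?\<eta> (z $ i + s * (x $ i - z $ i)) \<le>
      ?\<eta> (z $ i) + s * (?\<eta> (x $ i) - ?\<eta> (z $ i)) + s * ln s * (if z $ i = 0 then x $ i else 0)" for i
  proof (cases "z $ i = 0")
    case True
    then show ?thesis
      using s x_i[of i] by (simp add: ln_mult algebra_simps)
  next
    case False
    define p where "p = z $ i + s * (x $ i - z $ i)"
    have p_eq: "p = (1 - s) * z $ i + s * x $ i"
      by (simp add: p_def algebra_simps)
    have "0 < s * x $ i" "0 \<le> (1 - s) * z $ i"
      using s x_i[of i] z_i[of i] by auto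
    then have "0 < p" by (simp add: p_eq)
    \<comment> \<open>The two tangent inequalities at \<open>p\<close>, weighted by
      \<open>1 - s\<close> and \<open>s\<close>, add up to convexity, since \<open>p\<close> is the
      weighted mean.\<close>
    have "(1 - s) * (z $ i * ln p + z $ i - p) + s * (x $ i * ln p + x $ i - p)
        \<le> (1 - s) * ?\<eta> (z $ i) + s * ?\<eta> (x $ i)"
      using s x_i[of i] z_i[of i] \<open>0 < p\<close>
      by (intro add_mono mult_left_mono entropy_above_tangent) auto
    also have "(1 - s) * (z $ i * ln p + z $ i - p) + s * (x $ i * ln p + x $ i - p)
        = ((1 - s) * z $ i + s * x $ i) * ln p + (((1 - s) * z $ i + s * x $ i) - p)"
      by (simp add: algebra_simps)
    also have "\<dots> = ?\<eta> p" by (simp flip: p_eq)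
    finally show ?thesis
      using False by (simp add: p_def algebra_simps)
  qed
  then have "(\<Sum>i\<in>UNIV. ?\<eta> (z $ i + s * (x $ i - z $ i))) \<le>
      (\<Sum>i\<in>UNIV. ?\<eta> (z $ i) + s * (?\<eta> (x $ i) - ?\<eta> (z $ i))
        + s * ln s * (if z $ i = 0 then x $ i else 0))"
    by (rule sum_mono)
  then show ?thesis
    by (simp add: shannon_def sum.distrib sum_subtractf sum.If_cases flip: sum_distrib_left)
qed

text \<open>The right side is the sum of the Bregman distances in both orders, and the reverse one
  is nonnegative.\<close>

lemma bregman_shannon_le_symmetrized:
  fixes x y :: "real ^ 'n"
  assumes x: "x \<in> pos_orthant" and y: "y \<in> pos_orthant"
  shows "bregman_shannon y x \<le> (grad_shannon y - grad_shannon x) \<bullet> (y - x)"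
proof -
  have "(\<Sum>i\<in>UNIV. x $ i * ln (y $ i) + x $ i - y $ i) \<le> (\<Sum>i\<in>UNIV. x $ i * ln (x $ i))"
    using x y by (intro sum_mono entropy_above_tangent) (auto simp: pos_orthant_def less_imp_le)
  then show ?thesis
    by (simp add: bregman_shannon_def shannon_def grad_shannon_def inner_vec_def
        algebra_simps sum.distrib sum_subtractf)
qed

lemma GDERIV_bregman_shannon:
  assumes "z \<in> pos_orthant"
  shows "GDERIV (\<lambda>y. bregman_shannon y x) z :> grad_shannon z - grad_shannon x"
proof -
  have "(shannon has_derivative (\<lambda>h. h \<bullet> grad_shannon z)) (at z)"
    using GDERIV_shannon[OF assms] by (simp add: gderiv_def)
  then have "((\<lambda>y. shannon y - shannon x - grad_shannon x \<bullet> (y - x)) has_derivative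
      (\<lambda>h. h \<bullet> grad_shannon z - 0 - grad_shannon x \<bullet> (h - 0))) (at z)"
    by (auto intro!: derivative_eq_intros)
  then show ?thesis
    by (simp add: gderiv_def bregman_shannon_def inner_diff_right inner_commute)
qed

text \<open>
  A step of length \<open>s\<close> from a boundary point into the interior changes the linear terms by
  \<open>O(s)\<close> but the entropy by a negative multiple of \<open>-s ln s\<close>.
\<close>

lemma entropic_argmin_in_pos_orthant:
  fixes x z g :: "real ^ 'n"
  assumes min: "is_arg_min (\<lambda>y. c + g \<bullet> (y - x) + \<beta> * bregman_shannon y x) (\<lambda>y. y \<in> D) z"
    and D: "convex D" "D \<subseteq> nonneg_orthant" and x: "x \<in> D \<inter> pos_orthant" and \<beta>: "0 < \<beta>"
  shows "z \<in> pos_orthant"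
proof (rule ccontr)
  assume not_pos: "z \<notin> pos_orthant"
  have "z \<in> D" using min by (simp add: is_arg_min_def)
  then have z: "z \<in> nonneg_orthant" using D by auto
  from not_pos z obtain j where j: "z $ j = 0"
    by (auto simp: pos_orthant_def nonneg_orthant_def less_le)
  define X where "X = (\<Sum>i | z $ i = 0. x $ i)"
  have "0 < X"
    unfolding X_def using x j
    by (intro sum_pos) (auto simp: pos_orthant_def)
  define C where "C = g \<bullet> (x - z) + \<beta> * (shannon x - shannon z - grad_shannon x \<bullet> (x - z))"
  have bound: "0 \<le> C + \<beta> * X * ln s" if s: "0 < s" "s \<le> 1" for s
  proof -
    have "z + s *\<^sub>R (x - z) = (1 - s) *\<^sub>R z + s *\<^sub>R x"
      by (simp add: algebra_simps)
    then have "z + s *\<^sub>R (x - z) \<in> D"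
      using convexD_alt[OF D(1) \<open>z \<in> D\<close>, of x s] x s by simp
    then have "c + g \<bullet> (z - x) + \<beta> * bregman_shannon z x \<le>
        c + g \<bullet> (z + s *\<^sub>R (x - z) - x) + \<beta> * bregman_shannon (z + s *\<^sub>R (x - z)) x"
      using min by (auto simp: is_arg_min_def not_less)
    then have "0 \<le> s * (g \<bullet> (x - z)) + \<beta> * (shannon (z + s *\<^sub>R (x - z)) - shannon z
        - s * (grad_shannon x \<bullet> (x - z)))"
      by (simp add: bregman_shannon_def inner_add_right inner_diff_right algebra_simps)
    also have "\<dots> \<le> s * (g \<bullet> (x - z)) + \<beta> * (s * (shannon x - shannon z) + s * ln s * X
        - s * (grad_shannon x \<bullet> (x - z)))"
      using shannon_at_boundary[OF z _ s, of x] x \<beta>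
      by (intro add_left_mono mult_left_mono) (auto simp: X_def)
    also have "\<dots> = s * (C + \<beta> * X * ln s)"
      by (simp add: C_def algebra_simps)
    finally show ?thesis using s by (simp add: zero_le_mult_iff)
  qed
  \<comment> \<open>Chosen so that \<open>\<beta> * X * ln s\<close> equals
    \<open>- \<bar>C\<bar> - \<beta> * X\<close>, which makes the bound negative.\<close>
  define s where "s = exp (- \<bar>C\<bar> / (\<beta> * X) - 1)"
  have "0 < \<beta> * X" using \<beta> \<open>0 < X\<close> by simp
  then have "\<beta> * X * ln s = - \<bar>C\<bar> - \<beta> * X" 
    using \<beta> \<open>0 < X\<close> by (simp add: s_def field_simps)
  moreover have "s \<le> 1"
    using \<open>0 < \<beta> * X\<close> by (simp add: s_def) (smt (verit) divide_nonneg_pos)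
  ultimately show False
    using bound[of s] \<open>0 < \<beta> * X\<close> by (simp add: s_def)
qed

text \<open>Since \<open>z\<close> is positive, small moves along \<open>d\<close> in both
  directions remain feasible, so the derivative of the objective along \<open>d\<close>
  vanishes.\<close>

lemma entropic_argmin_first_order:
  fixes A :: "real ^ 'n ^ 'm" and x z g :: "real ^ 'n"
  assumes min: "is_arg_min (\<lambda>y. c + g \<bullet> (y - x) + \<beta> * bregman_shannon y x)
      (\<lambda>y. y \<in> feasible_set A b) z"
    and z: "z \<in> pos_orthant" and d: "A *v d = 0"
  shows "(g + \<beta> *\<^sub>R (grad_shannon z - grad_shannon x)) \<bullet> d = 0"
proof -
  let ?J = "\<lambda>y. c + g \<bullet> (y - x) + \<beta> * bregman_shannon y x"
  let ?G = "g + \<beta> *\<^sub>R (grad_shannon z - grad_shannon x)"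
  have "((\<lambda>y. bregman_shannon y x) has_derivative
      (\<lambda>h. h \<bullet> (grad_shannon z - grad_shannon x))) (at z)"
    using GDERIV_bregman_shannon[OF z] by (simp add: gderiv_def)
  then have "(?J has_derivative
      (\<lambda>h. g \<bullet> (h - 0) + \<beta> * (h \<bullet> (grad_shannon z - grad_shannon x)))) (at z)"
    by (auto intro!: derivative_eq_intros)
  then have "GDERIV ?J z :> ?G"
    by (simp add: gderiv_def inner_add_right inner_commute)
  then have deriv: "((\<lambda>s. ?J (z + s *\<^sub>R d)) has_real_derivative ?G \<bullet> d) (at 0)"
    by (intro GDERIV_along_line) simp
  have "z \<in> feasible_set A b" using min by (simp add: is_arg_min_def)
  then have Az: "A *v (z + s *\<^sub>R d) = b" for s
    by (simp add: feasible_set_def matrix_vector_right_distrib d matrix_vector_mult_scaleR)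
  have "\<forall>\<^sub>F s in nhds 0. 0 < (z + s *\<^sub>R d) $ i" for i
  proof -
    have "((\<lambda>s. (z + s *\<^sub>R d) $ i) \<longlongrightarrow> (z + 0 *\<^sub>R d) $ i) (nhds 0)"
      by (intro tendsto_intros filterlim_ident)
    then show ?thesis
      using z by (intro order_tendstoD(1)) (auto simp: pos_orthant_def)
  qed
  then have "\<forall>\<^sub>F s in nhds 0. \<forall>i. 0 < (z + s *\<^sub>R d) $ i"
    by (simp add: eventually_all_finite)
  then obtain \<epsilon> where \<epsilon>: "0 < \<epsilon>" "\<And>s i. \<bar>s\<bar> < \<epsilon> \<Longrightarrow> 0 < (z + s *\<^sub>R d) $ i"
    by (auto simp: eventually_nhds_metric dist_real_def)
  show ?thesis
  proof (rule DERIV_local_min[OF deriv \<epsilon>(1)], intro allI impI)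
    fix s assume "\<bar>0 - s\<bar> < \<epsilon>"
    then have "z + s *\<^sub>R d \<in> feasible_set A b"
      using \<epsilon>(2)[of s] Az[of s] by (auto simp: feasible_set_def nonneg_orthant_def less_imp_le)
    then show "?J (z + 0 *\<^sub>R d) \<le> ?J (z + s *\<^sub>R d)"
      using min by (auto simp: is_arg_min_def not_less)
  qed
qed

text \<open>Both bounds come from \<open>t \<le> exp t - 1 \<le> t * exp t\<close>. They make the
  multiplicative update comparable to the change \<open>t\<close> of the logarithm.\<close>

lemma exp_diff_bounds:
  fixes t T :: real
  assumes "\<bar>t\<bar> \<le> T"
  shows abs_exp_minus_1_le: "\<bar>exp t - 1\<bar> \<le> exp T * \<bar>t\<bar>"
    and mult_exp_minus_1_ge: "exp (- T) * t\<^sup>2 \<le> t * (exp t - 1)"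
proof -
  have t: "- T \<le> t" "t \<le> T" "0 \<le> T" using assms by auto
  have neg: "exp t - 1 \<le> t * exp t"
    using exp_ge_add_one_self[of "- t"] mult_right_mono[of "1 - t" "exp (- t)" "exp t"]
    by (simp add: algebra_simps flip: exp_add)
  have pos: "t \<le> exp t - 1"
    using exp_ge_add_one_self[of t] by linarith
  show "\<bar>exp t - 1\<bar> \<le> exp T * \<bar>t\<bar>"
  proof (cases "0 \<le> t")
    case True
    have "t * exp t \<le> t * exp T" using True t by (intro mult_left_mono) auto
    with neg pos True show ?thesis by (simp add: mult.commute)
  next
    case False
    then have abs_eq: "\<bar>t\<bar> = - t" "\<bar>exp t - 1\<bar> = 1 - exp t" by auto
    have "1 * (- t) \<le> exp T * (- t)" using False t by (intro mult_right_mono) auto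
    with pos show ?thesis unfolding abs_eq by linarith
  qed
  show "exp (- T) * t\<^sup>2 \<le> t * (exp t - 1)"
  proof (cases "0 \<le> t")
    case True
    have "exp (- T) * t\<^sup>2 \<le> 1 * t\<^sup>2" using t by (intro mult_right_mono) auto
    also have "\<dots> \<le> t * (exp t - 1)"
      using mult_left_mono[OF pos True] by (simp add: power2_eq_square)
    finally show ?thesis .
  next
    case False
    have "exp (- T) * t\<^sup>2 \<le> exp t * t\<^sup>2" using t by (intro mult_right_mono) auto
    also have "\<dots> = t * (t * exp t)" by (simp add: power2_eq_square)
    also have "\<dots> \<le> t * (exp t - 1)" using neg False by (intro mult_left_mono_neg) auto
    finally show ?thesis .
  qed
qed


section \<open>The feasible set, contractions and desingularizing functions\<close>

lemma orthant_extension_penalized: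
  "orthant_extension (penalized f (feasible_set A b)) = penalized f (feasible_set A b)"
  by (auto simp: orthant_extension_def penalized_def convex_indicator_def feasible_set_def)

lemma convex_feasible_set: "convex (feasible_set A b)"
  unfolding convex_alt feasible_set_def nonneg_orthant_def
  by (auto simp: matrix_vector_right_distrib matrix_vector_mult_scaleR simp flip: scaleR_left_distrib)

lemma closed_feasible_set:
  fixes A :: "real ^ 'n ^ 'm"
  shows "closed (feasible_set A b)"
proof -
  have "feasible_set A b = {x. A *v x = b} \<inter> (\<Inter>i. {x. 0 \<le> x $ i})"
    by (auto simp: feasible_set_def nonneg_orthant_def)
  moreover have "closed {x. A *v x = b}"
    by (intro closed_Collect_eq continuous_intros)
  moreover have "closed {x :: real ^ 'n. 0 \<le> x $ i}" for i :: 'n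
    by (intro closed_Collect_le continuous_intros)
  ultimately show ?thesis by (auto intro!: closed_Int closed_INT)
qed

lemma Q_linear_if_contraction:
  fixes w :: "nat \<Rightarrow> real"
  assumes q: "q < 1" and low: "\<And>k. l \<le> w k"
    and contr: "\<And>k. N \<le> k \<Longrightarrow> w (Suc k) - l \<le> q * (w k - l)"
  shows "Q_linear w l"
proof -
  \<comment> \<open>Q-linear convergence demands a positive factor, whereas \<open>q\<close> may be
    zero or negative.\<close>
  have "w (Suc k) - l \<le> max q (1 / 2) * (w k - l)" if "N \<le> k" for k
    using contr[OF that] low[of k] mult_right_mono[of q "max q (1 / 2)" "w k - l"] by simp
  then have "\<forall>k\<ge>N. norm (w (Suc k) - l) \<le> max q (1 / 2) * norm (w k - l)"
    using low by auto
  moreover have "0 < max q (1 / 2)" "max q (1 / 2) < 1" using q by auto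
  ultimately show ?thesis unfolding Q_linear_def by blast
qed

text \<open>A concave function lies below its tangent at \<open>s\<close>. The point
  \<open>u\<close> may be the endpoint 0, where \<open>\<phi>\<close> need not be
  differentiable.\<close>

lemma desingularizing_deriv_mult_diff_le:
  assumes des: "desingularizing \<eta> \<phi>" and s: "0 < s" "ereal s < \<eta>" and u: "0 \<le> u" "u \<le> s"
  shows "deriv \<phi> s * (s - u) \<le> \<phi> s - \<phi> u"
proof -
  let ?I = "{s. 0 \<le> s \<and> ereal s < \<eta>}"
  have conv: "convex_on ?I (\<lambda>s. - \<phi> s)"
    using des by (simp add: desingularizing_def concave_on_def)
  obtain s' where s': "ereal s < ereal s'" "ereal s' < \<eta>"
    using ereal_dense2[OF s(2)] by blast
  have "{0<..<s'} \<subseteq> ?I"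
    using s' by (auto intro: order.strict_trans[of "ereal _" "ereal s'"])
  then have "s \<in> interior ?I"
    using s s' by (intro interiorI[of "{0<..<s'}"]) auto
  moreover have "(\<phi> has_real_derivative deriv \<phi> s) (at s)"
    using des s by (simp add: desingularizing_def DERIV_deriv_iff_real_differentiable)
  then have "((\<lambda>s. - \<phi> s) has_field_derivative - deriv \<phi> s) (at s within ?I)"
    by (rule has_field_derivative_at_within[OF DERIV_minus])
  moreover have "u \<in> ?I"
    using u s by (auto intro: order.strict_trans1[of "ereal u" "ereal s"])
  moreover have "connected ?I"
    using conv by (intro convex_connected) (simp add: convex_on_def)
  ultimately have "- deriv \<phi> s * (u - s) \<le> - \<phi> u - - \<phi> s"
    by (intro convex_on_imp_above_tangent[OF conv])
  then show ?thesis by (simp add: algebra_simps)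
qed

section \<open>Optimality, boundedness and descent along the iteration\<close>

locale entropic_bpgm =
  fixes A :: "real ^ 'n ^ 'm" and b :: "real ^ 'm"
    and f :: "real ^ 'n \<Rightarrow> real" and grad_f :: "real ^ 'n \<Rightarrow> real ^ 'n"
    and L \<alpha>_lo \<alpha>_hi :: real and \<alpha> :: "nat \<Rightarrow> real" and x :: "nat \<Rightarrow> real ^ 'n"
  assumes gradient: "\<And>y. GDERIV f y :> grad_f y"
    and gradient_continuous: "continuous_on UNIV grad_f"
    and L_pos: "0 < L"
    and rel_smooth: "relatively_smooth_on (feasible_set A b) L shannon f"
    and step_bounds: "0 < \<alpha>_lo" "\<alpha>_hi < 1 / L"
    and steps: "\<And>k. \<alpha> k \<in> {\<alpha>_lo..\<alpha>_hi}"
    and bpgm: "bpgm_sequence (feasible_set A b) f grad_f \<alpha> x"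
    and bounded: "bounded (range x)"
begin

abbreviation "D \<equiv> feasible_set A b"
abbreviation "F \<equiv> penalized f D"

definition t :: "nat \<Rightarrow> real ^ 'n" where
  "t k = grad_shannon (x (Suc k)) - grad_shannon (x k)"

definition e :: "nat \<Rightarrow> real" where
  "e k = norm (diag_sqrt (x k) (t k))"

lemma \<alpha>_pos: "0 < \<alpha> k"
  using steps[of k] step_bounds by auto

lemma argmin:
  "is_arg_min (\<lambda>y. f (x k) + grad_f (x k) \<bullet> (y - x k) + 1 / \<alpha> k * bregman_shannon y (x k))
     (\<lambda>y. y \<in> D) (x (Suc k))"
  using bpgm by (simp add: bpgm_sequence_def)

lemma x_in: "x k \<in> D \<inter> pos_orthant"
proof (induction k)
  case 0
  then show ?case using bpgm by (simp add: bpgm_sequence_def)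
next
  case (Suc k)
  have "x (Suc k) \<in> pos_orthant"
    by (rule entropic_argmin_in_pos_orthant[OF argmin convex_feasible_set _ Suc])
       (use \<alpha>_pos[of k] in \<open>auto simp: feasible_set_def\<close>)
  then show ?case using argmin[of k] by (simp add: is_arg_min_def)
qed

lemma x_pos: "0 < x k $ i"
  using x_in[of k] by (simp add: pos_orthant_def)

lemma t_nth: "t k $ i = ln (x (Suc k) $ i) - ln (x k $ i)"
  by (simp add: t_def grad_shannon_def)

lemma x_Suc_nth: "x (Suc k) $ i = x k $ i * exp (t k $ i)"
  using x_pos[of k i] x_pos[of "Suc k" i] by (simp add: t_nth exp_diff)

lemma A_diff: "y \<in> D \<Longrightarrow> z \<in> D \<Longrightarrow> A *v (y - z) = 0"
  by (simp add: feasible_set_def matrix_vector_mult_diff_distrib)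

text \<open>Orthogonality to the kernel of \<open>A\<close> takes the place of an explicit
  multiplier for the constraint \<open>A *v x = b\<close>.\<close>

lemma optimality:
  assumes "A *v d = 0"
  shows "(\<alpha> k *\<^sub>R grad_f (x k) + t k) \<bullet> d = 0"
proof -
  have "(grad_f (x k) + (1 / \<alpha> k) *\<^sub>R t k) \<bullet> d = 0"
    unfolding t_def using entropic_argmin_first_order[OF argmin _ assms] x_in by blast
  then have "\<alpha> k * ((grad_f (x k) + (1 / \<alpha> k) *\<^sub>R t k) \<bullet> d) = 0" by simp
  then show ?thesis
    using \<alpha>_pos[of k] by (simp add: inner_add_left algebra_simps)
qed

text \<open>By \<open>optimality\<close> the normal condition holds with equality. The step uses the
  gradient at \<open>x k\<close>, so the subgradient belongs to the old iterate, whose entries are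
  also the weights in \<open>e k\<close>.\<close>

lemma subgradient: "- (1 / \<alpha> k) *\<^sub>R t k \<in> frechet_subdiff F (x k)"
proof (rule frechet_subdiff_penalizedI[OF gradient])
  show "x k \<in> D" using x_in by blast
  then show "0 \<le> (grad_f (x k) - - (1 / \<alpha> k) *\<^sub>R t k) \<bullet> (y - x k)" if "y \<in> D" for y
    using optimality[OF A_diff[OF that], of "x k" k] \<alpha>_pos[of k]
    by (simp add: inner_add_left inner_diff_left field_simps)
qed

lemma x_bounded: obtains X where "0 < X" "\<And>k i. x k $ i \<le> X"
proof -
  obtain X where X: "0 < X" "\<And>k. norm (x k) \<le> X"
    using bounded unfolding bounded_pos by auto
  then have "x k $ i \<le> X" for k i
    using component_le_norm_cart[of "x k" i] X(2)[of k] by linarith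
  with X(1) show thesis by (rule that)
qed

lemma t_bounded: obtains T where "\<And>k i. \<bar>t k $ i\<bar> \<le> T"
proof -
  have "compact (grad_f ` closure (range x))"
    using bounded gradient_continuous
    by (intro compact_continuous_image) (auto intro: continuous_on_subset)
  then obtain G where G: "\<And>y. y \<in> closure (range x) \<Longrightarrow> norm (grad_f y) \<le> G"
    by (meson bounded_iff compact_imp_bounded imageI)
  have G_x: "norm (grad_f (x k)) \<le> G" for k
    by (intro G subsetD[OF closure_subset]) auto
  let ?V = "{v. \<forall>d. A *v d = 0 \<longrightarrow> v \<bullet> d = 0}"
  have V: "subspace ?V"
    by (auto simp: subspace_def inner_add_left)
  obtain T where T: "\<And>u w d. w \<in> ?V \<Longrightarrow> norm (u - w) \<le> \<alpha>_hi * G \<Longrightarrow>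
      (\<And>v. v \<in> ?V \<Longrightarrow> v \<bullet> d = 0) \<Longrightarrow> (\<And>i. sgn (d $ i) = sgn (u $ i)) \<Longrightarrow> norm u \<le> T"
    by (rule bounded_if_near_subspace_and_signs_orthogonal[OF V, where B = "\<alpha>_hi * G"]) blast
  \<comment> \<open>The nearby element of \<open>V\<close> is \<open>t k\<close> plus the scaled
    gradient; \<open>x (Suc k) - x k\<close> lies in the kernel of \<open>A\<close> and has the
    signs of \<open>t k\<close>.\<close>
  have "norm (t k) \<le> T" for k
  proof (rule T)
    show "\<alpha> k *\<^sub>R grad_f (x k) + t k \<in> ?V"
      using optimality by blast
    have "\<alpha> k * norm (grad_f (x k)) \<le> \<alpha>_hi * G"
      using steps[of k] \<alpha>_pos[of k] G_x[of k] by (intro mult_mono) auto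
    then show "norm (t k - (\<alpha> k *\<^sub>R grad_f (x k) + t k)) \<le> \<alpha>_hi * G"
      using \<alpha>_pos[of k] by simp
    show "v \<bullet> (x (Suc k) - x k) = 0" if "v \<in> ?V" for v
      using that A_diff[of "x (Suc k)" "x k"] x_in by blast
    show "sgn ((x (Suc k) - x k) $ i) = sgn (t k $ i)" for i
    proof -
      have "(x (Suc k) - x k) $ i = x k $ i * (exp (t k $ i) - 1)"
        by (simp add: x_Suc_nth algebra_simps)
      then show ?thesis
        using x_pos[of k i]
        by (cases "t k $ i" "0 :: real" rule: linorder_cases) (auto simp: sgn_mult)
    qed
  qed
  then have "\<bar>t k $ i\<bar> \<le> T" for k i
    using component_le_norm_cart[of "t k" i] by (meson order_trans)
  then show thesis by (rule that)
qed

lemma e_squared: "(e k)\<^sup>2 = (\<Sum>i\<in>UNIV. x k $ i * (t k $ i)\<^sup>2)"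
proof -
  have "(e k)\<^sup>2 = diag_sqrt (x k) (t k) \<bullet> diag_sqrt (x k) (t k)"
    by (simp add: e_def power2_norm_eq_inner)
  also have "\<dots> = (\<Sum>i\<in>UNIV. (sqrt (x k $ i) * t k $ i)\<^sup>2)"
    by (simp add: inner_vec_def diag_sqrt_def power2_eq_square)
  also have "\<dots> = (\<Sum>i\<in>UNIV. x k $ i * (t k $ i)\<^sup>2)"
    using x_pos by (simp add: power_mult_distrib less_imp_le)
  finally show ?thesis .
qed

lemma e_nonneg: "0 \<le> e k" by (simp add: e_def)

text \<open>Relative smoothness is the tangent inequality of \<open>L h - f\<close> at
  \<open>x k\<close>. Optimality turns its linear term into \<open>- 1 / \<alpha> k\<close> times
  the inner product of \<open>t k\<close> with the step, and the Bregman term costs at most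
  \<open>L\<close> times that product.\<close>

lemma descent_symmetrized: "(1 / \<alpha>_hi - L) * (t k \<bullet> (x (Suc k) - x k)) \<le> f (x k) - f (x (Suc k))"
proof -
  let ?d = "x (Suc k) - x k"
  have pos: "x k \<in> pos_orthant" "x (Suc k) \<in> pos_orthant" and inD: "x k \<in> D" "x (Suc k) \<in> D"
    using x_in by auto
  have t_nonneg: "0 \<le> t k \<bullet> ?d"
  proof -
    have "t k \<bullet> ?d = (\<Sum>i\<in>UNIV. x k $ i * (t k $ i * (exp (t k $ i) - 1)))"
      by (simp add: inner_vec_def x_Suc_nth algebra_simps)
    also have "\<dots> \<ge> 0"
      using x_pos[of k] by (intro sum_nonneg) (auto simp: zero_le_mult_iff less_imp_le)
    finally show ?thesis .
  qed
  have "GDERIV (\<lambda>y. L * shannon y - f y) (x k) :> L *\<^sub>R grad_shannon (x k) - grad_f (x k)"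
  proof -
    have "((\<lambda>y. L * shannon y - f y) has_derivative
        (\<lambda>h. L * (h \<bullet> grad_shannon (x k)) - h \<bullet> grad_f (x k))) (at (x k))"
      using GDERIV_shannon[OF pos(1)] gradient[of "x k"]
      by (auto intro!: derivative_eq_intros simp: gderiv_def)
    then show ?thesis by (simp add: gderiv_def inner_diff_right)
  qed
  from convex_on_above_tangent[OF _ inD this] rel_smooth
  have "f (x (Suc k)) \<le> f (x k) + grad_f (x k) \<bullet> ?d + L * bregman_shannon (x (Suc k)) (x k)"
    by (simp add: relatively_smooth_on_def bregman_shannon_def inner_diff_left algebra_simps)
  also have "grad_f (x k) \<bullet> ?d = - (1 / \<alpha> k) * (t k \<bullet> ?d)"
    using optimality[OF A_diff[OF inD(2,1)], of k] \<alpha>_pos[of k]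
    by (simp add: inner_add_left field_simps)
  also have "L * bregman_shannon (x (Suc k)) (x k) \<le> L * (t k \<bullet> ?d)"
    using bregman_shannon_le_symmetrized[OF pos] L_pos by (simp add: t_def)
  finally have "(1 / \<alpha> k - L) * (t k \<bullet> ?d) \<le> f (x k) - f (x (Suc k))"
    by (simp add: algebra_simps)
  moreover have "(1 / \<alpha>_hi - L) * (t k \<bullet> ?d) \<le> (1 / \<alpha> k - L) * (t k \<bullet> ?d)"
    using steps[of k] \<alpha>_pos[of k] t_nonneg
    by (intro mult_right_mono diff_right_mono divide_left_mono) auto
  ultimately show ?thesis by simp
qed

lemma descent: obtains c where "0 < c" "\<And>k. c * (e k)\<^sup>2 \<le> f (x k) - f (x (Suc k))"
proof -
  obtain T where T: "\<And>k i. \<bar>t k $ i\<bar> \<le> T" using t_bounded by blast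
  have "0 < \<alpha>_hi" using steps[of 0] \<alpha>_pos[of 0] by simp
  then have L: "0 < 1 / \<alpha>_hi - L"
    using step_bounds L_pos by (simp add: field_simps)
  have "(1 / \<alpha>_hi - L) * exp (- T) * (e k)\<^sup>2 \<le> f (x k) - f (x (Suc k))" for k
  proof -
    have "exp (- T) * (e k)\<^sup>2 = (\<Sum>i\<in>UNIV. x k $ i * (exp (- T) * (t k $ i)\<^sup>2))"
      by (simp add: e_squared sum_distrib_left algebra_simps)
    also have "\<dots> \<le> (\<Sum>i\<in>UNIV. x k $ i * (t k $ i * (exp (t k $ i) - 1)))"
      using x_pos by (intro sum_mono mult_left_mono mult_exp_minus_1_ge T) (auto simp: less_imp_le)
    also have "\<dots> = t k \<bullet> (x (Suc k) - x k)"
      by (simp add: inner_vec_def x_Suc_nth algebra_simps)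
    finally have "(1 / \<alpha>_hi - L) * (exp (- T) * (e k)\<^sup>2) \<le>
        (1 / \<alpha>_hi - L) * (t k \<bullet> (x (Suc k) - x k))"
      using L by (intro mult_left_mono) auto
    with descent_symmetrized[of k] show ?thesis by simp
  qed
  with L show thesis by (intro that[of "(1 / \<alpha>_hi - L) * exp (- T)"]) auto
qed

lemma step_length: obtains c where "0 < c" "\<And>k. norm (x (Suc k) - x k) \<le> c * e k"
proof -
  obtain T where T: "\<And>k i. \<bar>t k $ i\<bar> \<le> T" using t_bounded by blast
  obtain X where X: "0 < X" "\<And>k i. x k $ i \<le> X" using x_bounded by blast
  have "norm (x (Suc k) - x k) \<le> sqrt X * exp T * e k" for k
  proof (rule power2_le_imp_le)
    have "(norm (x (Suc k) - x k))\<^sup>2 = (\<Sum>i\<in>UNIV. (x k $ i * (exp (t k $ i) - 1))\<^sup>2)"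
      unfolding power2_norm_eq_inner
      by (simp add: inner_vec_def x_Suc_nth power2_eq_square algebra_simps)
    also have "\<dots> \<le> (\<Sum>i\<in>UNIV. X * (exp T)\<^sup>2 * (x k $ i * (t k $ i)\<^sup>2))"
    proof (rule sum_mono)
      fix i
      have "(exp (t k $ i) - 1)\<^sup>2 \<le> (exp T * \<bar>t k $ i\<bar>)\<^sup>2"
        using power_mono[OF abs_exp_minus_1_le[OF T[of k i]], of 2] by simp
      then have "(exp (t k $ i) - 1)\<^sup>2 \<le> (exp T)\<^sup>2 * (t k $ i)\<^sup>2"
        by (simp add: power_mult_distrib)
      then have "(x k $ i * x k $ i) * (exp (t k $ i) - 1)\<^sup>2 \<le>
          (x k $ i * x k $ i) * ((exp T)\<^sup>2 * (t k $ i)\<^sup>2)"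
        by (rule mult_left_mono) simp
      \<comment> \<open>One factor \<open>x k $ i\<close> is traded for \<open>X\<close>; the other
        remains as the weight in \<open>(e k)\<^sup>2\<close>.\<close>
      also have "\<dots> \<le> (X * x k $ i) * ((exp T)\<^sup>2 * (t k $ i)\<^sup>2)"
        using X x_pos[of k i] by (intro mult_right_mono) auto
      finally show "(x k $ i * (exp (t k $ i) - 1))\<^sup>2 \<le> X * (exp T)\<^sup>2 * (x k $ i * (t k $ i)\<^sup>2)"
        by (simp only: power_mult_distrib power2_eq_square[of "x k $ i"] mult_ac)
    qed
    also have "\<dots> = (sqrt X * exp T * e k)\<^sup>2"
      using X(1) by (simp add: power_mult_distrib e_squared sum_distrib_left)
    finally show "(norm (x (Suc k) - x k))\<^sup>2 \<le> (sqrt X * exp T * e k)\<^sup>2" .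
  qed (use X(1) e_nonneg in auto)
  with X(1) show thesis by (intro that[of "sqrt X * exp T"]) auto
qed

text \<open>Splitting each \<open>x k $ i\<close> into two square roots leaves one as a bounded
  factor and the other as the weight in \<open>e k\<close>. Thus these products vanish with
  \<open>e k\<close> although \<open>t k\<close> itself need not.\<close>

lemma inner_x_t: obtains c where "\<And>k. \<bar>x k \<bullet> t k\<bar> \<le> c * e k"
proof -
  obtain X where X: "0 < X" "\<And>k i. x k $ i \<le> X" using x_bounded by blast
  have "\<bar>x k \<bullet> t k\<bar> \<le> real CARD('n) * sqrt X * e k" for k
  proof -
    have "\<bar>x k \<bullet> t k\<bar> \<le> (\<Sum>i\<in>UNIV. \<bar>x k $ i * t k $ i\<bar>)"
      by (simp add: inner_vec_def)
    also have "\<dots> \<le> (\<Sum>i\<in>(UNIV :: 'n set). sqrt X * e k)"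
    proof (rule sum_mono)
      fix i
      have "\<bar>x k $ i * t k $ i\<bar> = sqrt (x k $ i) * \<bar>diag_sqrt (x k) (t k) $ i\<bar>"
        using x_pos[of k i] by (simp add: diag_sqrt_def abs_mult flip: mult.assoc)
      also have "\<dots> \<le> sqrt X * e k"
        using X x_pos[of k i] unfolding e_def
        by (intro mult_mono component_le_norm_cart) auto
      finally show "\<bar>x k $ i * t k $ i\<bar> \<le> sqrt X * e k" .
    qed
    finally show ?thesis by simp
  qed
  then show thesis by (rule that)
qed

section \<open>Cluster points and the SKL inequality along the iterates\<close>

lemma f_decseq: "decseq (\<lambda>k. f (x k))"
proof -
  obtain c where "0 < c" "\<And>k. c * (e k)\<^sup>2 \<le> f (x k) - f (x (Suc k))"
    using descent by blast
  then have "f (x (Suc k)) \<le> f (x k)" for k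
    by (smt (verit) mult_nonneg_nonneg zero_le_power2)
  then show ?thesis by (rule decseq_SucI)
qed

lemma isCont_f: "isCont f y"
  using gradient[of y] unfolding gderiv_def by (rule has_derivative_continuous)

lemma cluster_value:
  assumes r: "strict_mono r" and lim: "(x \<circ> r) \<longlonglongrightarrow> xs"
  shows "xs \<in> D" "f xs \<le> f (x k)" "(\<lambda>k. f (x k)) \<longlonglongrightarrow> f xs"
proof -
  show "xs \<in> D"
    using closed_sequentially[OF closed_feasible_set _ lim] x_in by auto
  have sub: "(\<lambda>j. f (x (r j))) \<longlonglongrightarrow> f xs"
    using isCont_tendsto_compose[OF isCont_f lim] by (simp add: o_def)
  have le: "f xs \<le> f (x k)" for k
  proof (rule tendsto_upperbound[OF sub])
    show "\<forall>\<^sub>F j in sequentially. f (x (r j)) \<le> f (x k)"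
      using eventually_ge_at_top[of k]
      by eventually_elim (use seq_suble[OF r] decseqD[OF f_decseq] order_trans in blast)
  qed simp
  then show "f xs \<le> f (x k)" .
  obtain l where l: "(\<lambda>k. f (x k)) \<longlonglongrightarrow> l"
    using decseq_convergent[OF f_decseq allI[OF le]] by blast
  from LIMSEQ_subseq_LIMSEQ[OF this r] sub have "l = f xs"
    by (intro LIMSEQ_unique[of "\<lambda>j. f (x (r j))"]) (auto simp: o_def)
  with l show "(\<lambda>k. f (x k)) \<longlonglongrightarrow> f xs" by simp
qed

lemma e_tendsto_0:
  assumes "(\<lambda>k. f (x k)) \<longlonglongrightarrow> l"
  shows "e \<longlonglongrightarrow> 0"
proof -
  obtain c where c: "0 < c" "\<And>k. c * (e k)\<^sup>2 \<le> f (x k) - f (x (Suc k))"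
    using descent by blast
  have "(\<lambda>k. (f (x k) - f (x (Suc k))) / c) \<longlonglongrightarrow> (l - l) / c"
    using c(1) by (intro tendsto_intros assms LIMSEQ_Suc[OF assms]) auto
  then have "(\<lambda>k. (f (x k) - f (x (Suc k))) / c) \<longlonglongrightarrow> 0" by simp
  then have "(\<lambda>k. (e k)\<^sup>2) \<longlonglongrightarrow> 0"
    by (rule tendsto_sandwich[OF _ _ tendsto_const, rotated 2])
       (use c in \<open>auto intro!: always_eventually simp: field_simps\<close>)
  from tendsto_real_sqrt[OF this] show ?thesis
    by (simp add: e_nonneg)
qed

lemma penalized_eq: "y \<in> D \<Longrightarrow> F y = ereal (f y)"
  by (simp add: penalized_def convex_indicator_def)

text \<open>The SKL property can be invoked only where the subdifferential is nonempty. The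
  subgradients \<open>- t k / \<alpha> k\<close> are bounded, so a further subsequence of them
  converges; its limit is not known to be zero at this stage.\<close>

lemma cluster_in_dom_subdiff:
  assumes r: "strict_mono r" and lim: "(x \<circ> r) \<longlonglongrightarrow> xs"
  shows "xs \<in> dom_subdiff F"
proof -
  define v where "v k = - (1 / \<alpha> k) *\<^sub>R t k" for k
  have v: "v k \<in> frechet_subdiff F (x k)" for k
    unfolding v_def by (rule subgradient)
  obtain T where T: "\<And>k i. \<bar>t k $ i\<bar> \<le> T" using t_bounded by blast
  have "norm (v k) \<le> 1 / \<alpha>_lo * (real CARD('n) * T)" for k
  proof -
    have "norm (t k) \<le> (\<Sum>i\<in>UNIV. \<bar>t k $ i\<bar>)" by (rule norm_le_l1_cart)
    also have "\<dots> \<le> real CARD('n) * T"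
      by (rule sum_bounded_above) (rule T)
    finally have "norm (t k) \<le> real CARD('n) * T" .
    moreover have "1 / \<alpha> k \<le> 1 / \<alpha>_lo"
      using steps[of k] step_bounds by (intro divide_left_mono) auto
    ultimately have "1 / \<alpha> k * norm (t k) \<le> 1 / \<alpha>_lo * (real CARD('n) * T)"
      using \<alpha>_pos[of k] step_bounds by (intro mult_mono) auto
    then show ?thesis using \<alpha>_pos[of k] by (simp add: v_def)
  qed
  then have "bounded (range (v \<circ> r))" unfolding bounded_iff by auto
  then obtain w r' where r': "strict_mono r'" and w: "((v \<circ> r) \<circ> r') \<longlonglongrightarrow> w"
    using bounded_imp_convergent_subsequence by blast
  have lim': "(\<lambda>j. x (r (r' j))) \<longlonglongrightarrow> xs"
    using LIMSEQ_subseq_LIMSEQ[OF lim r'] by (simp add: o_def)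
  have "(\<lambda>j. F (x (r (r' j)))) \<longlonglongrightarrow> F xs"
    using isCont_tendsto_compose[OF isCont_f lim'] x_in cluster_value(1)[OF r lim]
    by (simp add: penalized_eq)
  with w v lim' have "w \<in> limiting_subdiff F xs"
    using cluster_value(1)[OF r lim]
    unfolding limiting_subdiff_def
    by (intro CollectI conjI exI[of _ "\<lambda>j. x (r (r' j))"] exI[of _ "\<lambda>j. v (r (r' j))"])
       (auto simp: o_def penalized_eq)
  then show ?thesis by (auto simp: dom_subdiff_def)
qed

lemma dist_zero_subdiff_le:
  "dist_zero (diag_sqrt (x k) ` limiting_subdiff F (x k)) \<le> ereal (e k / \<alpha> k)"
proof -
  have "diag_sqrt (x k) (- (1 / \<alpha> k) *\<^sub>R t k) = - (1 / \<alpha> k) *\<^sub>R diag_sqrt (x k) (t k)"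
    by (simp add: diag_sqrt_def vec_eq_iff)
  then have "norm (diag_sqrt (x k) (- (1 / \<alpha> k) *\<^sub>R t k)) = e k / \<alpha> k"
    using \<alpha>_pos[of k] by (simp add: e_def)
  then show ?thesis
    using dist_zero_le[OF imageI[OF subsetD[OF frechet_subset_limiting_subdiff subgradient]],
      of "diag_sqrt (x k)" k] by simp
qed

text \<open>Convergence of the values takes care of \<open>\<eta>\<close>. Membership in the ball
  remains a condition, since the iterates are not yet known to stay near \<open>xs\<close>.\<close>

lemma skl_along_iterates:
  assumes skl: "skl_with \<phi> F xs" and xs: "xs \<in> D"
    and lim: "(\<lambda>k. f (x k)) \<longlonglongrightarrow> f xs"
  obtains \<eta> \<rho> N where "desingularizing \<eta> \<phi>" "0 < \<rho>"
    "\<And>k. N \<le> k \<Longrightarrow> ereal (f (x k) - f xs) < \<eta>"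
    "\<And>k. N \<le> k \<Longrightarrow> x k \<in> ball xs \<rho> \<Longrightarrow> f xs < f (x k) \<Longrightarrow>
       \<alpha> k \<le> deriv \<phi> (f (x k) - f xs) * e k"
proof -
  from skl obtain \<eta> U where \<eta>: "0 < \<eta>" "open U" "xs \<in> U" "desingularizing \<eta> \<phi>"
    and ineq: "\<And>y. y \<in> U \<inter> nonneg_orthant \<Longrightarrow> F xs < F y \<Longrightarrow> F y < F xs + \<eta> \<Longrightarrow>
      1 \<le> ereal (deriv \<phi> (real_of_ereal (F y - F xs))) *
        dist_zero (diag_sqrt y ` limiting_subdiff F y)"
    unfolding skl_with_def orthant_extension_penalized by blast
  obtain \<rho> where \<rho>: "0 < \<rho>" "ball xs \<rho> \<subseteq> U"
    using \<eta>(2,3) open_contains_ball by blast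
  have "(\<lambda>k. ereal (f (x k) - f xs)) \<longlonglongrightarrow> ereal (f xs - f xs)"
    by (intro tendsto_intros lim)
  from order_tendstoD(2)[OF this, of \<eta>] \<eta>(1)
  have "\<forall>\<^sub>F k in sequentially. ereal (f (x k) - f xs) < \<eta>"
    by (simp flip: zero_ereal_def)
  then obtain N where N: "\<And>k. N \<le> k \<Longrightarrow> ereal (f (x k) - f xs) < \<eta>"
    unfolding eventually_sequentially by blast
  have "\<alpha> k \<le> deriv \<phi> (f (x k) - f xs) * e k"
    if k: "N \<le> k" "x k \<in> ball xs \<rho>" "f xs < f (x k)" for k
  proof -
    let ?d = "deriv \<phi> (f (x k) - f xs)"
    have x: "x k \<in> D" "x k \<in> nonneg_orthant"
      using x_in[of k] by (auto simp: feasible_set_def)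
    have "F (x k) < F xs + \<eta>"
      using N[OF k(1)] x xs by (cases \<eta>) (auto simp: penalized_eq)
    then have "1 \<le> ereal ?d * dist_zero (diag_sqrt (x k) ` limiting_subdiff F (x k))"
      using ineq[of "x k"] k \<rho>(2) x xs by (auto simp: penalized_eq)
    also have "\<dots> \<le> ereal ?d * ereal (e k / \<alpha> k)"
    proof (rule ereal_mult_left_mono[OF dist_zero_subdiff_le])
      have "0 < ?d" using \<eta>(4) k N by (simp add: desingularizing_def)
      then show "0 \<le> ereal ?d" by simp
    qed
    finally have "1 \<le> ?d * (e k / \<alpha> k)" by simp
    then show ?thesis using \<alpha>_pos[of k] by (simp add: field_simps)
  qed
  with \<eta>(4) \<rho>(1) N show thesis by (rule that)
qed

text \<open>This covers the case the SKL inequality leaves out, a value already equal to the limit: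
  no further decrease is possible, so the step is trivial.\<close>

lemma e_eq_0_if_stationary:
  assumes "\<And>k. l \<le> f (x k)" "f (x k) = l"
  shows "e k = 0" "f (x (Suc k)) = l"
proof -
  show "f (x (Suc k)) = l"
    using decseqD[OF f_decseq, of k "Suc k"] assms by (auto intro: antisym)
  moreover obtain c where "0 < c" "\<And>k. c * (e k)\<^sup>2 \<le> f (x k) - f (x (Suc k))"
    using descent by blast
  ultimately show "e k = 0"
    using assms(2) by (smt (verit) zero_less_mult_iff zero_less_power2)
qed

lemma iterates_convergent:
  assumes skl: "skl_function F"
  shows "\<exists>xs. x \<longlonglongrightarrow> xs"
proof -
  obtain xs r where r: "strict_mono r" and lim: "(x \<circ> r) \<longlonglongrightarrow> xs"
    using bounded_imp_convergent_subsequence[OF bounded] by blast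
  note xs = cluster_value[OF r lim]
  obtain \<phi> where "skl_with \<phi> F xs"
    using skl cluster_in_dom_subdiff[OF r lim]
    by (auto simp: skl_function_def skl_at_def orthant_extension_penalized)
  then obtain \<eta> \<rho> N where des: "desingularizing \<eta> \<phi>" and \<rho>: "0 < \<rho>"
    and N: "\<And>k. N \<le> k \<Longrightarrow> ereal (f (x k) - f xs) < \<eta>"
    and ineq: "\<And>k. N \<le> k \<Longrightarrow> x k \<in> ball xs \<rho> \<Longrightarrow> f xs < f (x k) \<Longrightarrow>
      \<alpha> k \<le> deriv \<phi> (f (x k) - f xs) * e k"
    using skl_along_iterates[OF _ xs(1,3)] by metis
  obtain c1 where c1: "0 < c1" "\<And>k. c1 * (e k)\<^sup>2 \<le> f (x k) - f (x (Suc k))"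
    using descent by blast
  obtain c2 where c2: "0 < c2" "\<And>k. norm (x (Suc k) - x k) \<le> c2 * e k"
    using step_length by blast
  \<comment> \<open>The chain below bounds \<open>\<alpha>_lo * c1 * e k\<close> by the drop of
    \<open>\<phi>\<close>, and \<open>c2\<close> converts \<open>e k\<close> into step
    length.\<close>
  define p where "p k = c2 / (c1 * \<alpha>_lo) * \<phi> (f (x k) - f xs)" for k
  have C: "0 < c2 / (c1 * \<alpha>_lo)" using c1 c2 step_bounds by simp
  have dom: "f (x k) - f xs \<in> {s. 0 \<le> s \<and> ereal s < \<eta>}" if "N \<le> k" for k
    using N[OF that] xs(2)[of k] by simp
  have "x \<longlonglongrightarrow> xs"
  proof (rule converges_to_cluster_point_if_steps_telescope[OF \<rho> _ _ _ r lim])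
    fix k assume k: "N \<le> k" "x k \<in> ball xs \<rho>"
    show "norm (x (Suc k) - x k) \<le> p k - p (Suc k)"
    proof (cases "f (x k) = f xs")
      case True
      then show ?thesis
        using e_eq_0_if_stationary[OF xs(2) True] c2(2)[of k] by (simp add: p_def)
    next
      case False
      then have pos: "f xs < f (x k)" using xs(2)[of k] by simp
      let ?d = "deriv \<phi> (f (x k) - f xs)"
      have "0 < ?d" using des pos N[OF k(1)] by (simp add: desingularizing_def)
      \<comment> \<open>Multiplying the SKL bound by \<open>c1 * e k\<close> produces the square
        that \<open>descent\<close> controls. Both estimates involve the same \<open>e k\<close>, so
        no earlier step has to be carried along.\<close>
      have "\<alpha>_lo * (c1 * e k) \<le> \<alpha> k * (c1 * e k)"
        using steps[of k] c1(1) e_nonneg[of k] by (intro mult_right_mono) auto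
      also have "\<dots> \<le> ?d * e k * (c1 * e k)"
        using ineq[OF k pos] c1(1) e_nonneg[of k] by (intro mult_right_mono) auto
      also have "\<dots> = ?d * (c1 * (e k)\<^sup>2)"
        by (simp add: power2_eq_square)
      also have "\<dots> \<le> ?d * ((f (x k) - f xs) - (f (x (Suc k)) - f xs))"
        using \<open>0 < ?d\<close> c1(2)[of k] by (intro mult_left_mono) auto
      also have "\<dots> \<le> \<phi> (f (x k) - f xs) - \<phi> (f (x (Suc k)) - f xs)"
        using pos xs(2)[of "Suc k"] decseqD[OF f_decseq, of k "Suc k"] N[OF k(1)]
        by (intro desingularizing_deriv_mult_diff_le[OF des]) auto
      finally have "c2 / (c1 * \<alpha>_lo) * (\<alpha>_lo * (c1 * e k)) \<le> p k - p (Suc k)"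
        unfolding p_def right_diff_distrib[symmetric] using C by (intro mult_left_mono) auto
      then show ?thesis
        using c2(2)[of k] c1(1) step_bounds by (simp add: field_simps)
    qed
  next
    have "(\<lambda>k. f (x k) - f xs) \<longlonglongrightarrow> f xs - f xs"
      by (intro tendsto_intros xs)
    moreover have "ereal 0 < \<eta>"
      using xs(2)[of N] N[of N] by (intro order.strict_trans1[of "ereal 0" "ereal (f (x N) - f xs)"]) auto
    then have "0 \<in> {s. 0 \<le> s \<and> ereal s < \<eta>}" by simp
    moreover have "\<forall>\<^sub>F k in sequentially. f (x k) - f xs \<in> {s. 0 \<le> s \<and> ereal s < \<eta>}"
      using dom unfolding eventually_sequentially by blast
    moreover have "continuous_on {s. 0 \<le> s \<and> ereal s < \<eta>} \<phi>"
      using des by (simp add: desingularizing_def)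
    ultimately have "(\<lambda>k. \<phi> (f (x k) - f xs)) \<longlonglongrightarrow> \<phi> 0"
      using continuous_on_tendsto_compose by fastforce
    from tendsto_mult_left[OF this, of "c2 / (c1 * \<alpha>_lo)"] show "p \<longlonglongrightarrow> 0"
      using des by (simp add: p_def[abs_def] desingularizing_def)
    show "0 \<le> p k" if "N \<le> k" for k
      unfolding p_def using des dom[OF that] C
      by (intro mult_nonneg_nonneg) (auto simp: desingularizing_def)
  qed
  then show ?thesis ..
qed

text \<open>
  Since \<open>t k\<close> is a difference of logarithms, \<open>t k \<bullet> y\<close> telescopes; for \<open>y \<ge> 0\<close> its sums are
  bounded above, whereas a feasible descent direction at the limit would make them grow linearly.
\<close>

lemma limit_critical:
  assumes lim: "x \<longlonglongrightarrow> xs"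
  shows "critical_point F xs"
proof -
  have id: "strict_mono (id :: nat \<Rightarrow> nat)" "(x \<circ> id) \<longlonglongrightarrow> xs"
    using lim by (simp_all add: strict_mono_def)
  note xs = cluster_value[OF id]
  have e0: "e \<longlonglongrightarrow> 0" by (rule e_tendsto_0[OF xs(3)])
  obtain X where X: "0 < X" "\<And>k i. x k $ i \<le> X" using x_bounded by blast
  obtain c where c: "\<And>k. \<bar>x k \<bullet> t k\<bar> \<le> c * e k" using inner_x_t by blast
  have "(\<lambda>k. c * e k) \<longlonglongrightarrow> 0" using tendsto_mult_right_zero[OF e0] .
  then have xt: "(\<lambda>k. x k \<bullet> t k) \<longlonglongrightarrow> 0"
    by (rule Lim_null_comparison[rotated]) (use c in \<open>auto intro: always_eventually\<close>)
  have "0 \<le> (grad_f xs - 0) \<bullet> (y - xs)" if y: "y \<in> D" for y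
  proof (rule ccontr)
    define \<delta> where "\<delta> = - (grad_f xs \<bullet> (y - xs))"
    assume "\<not> 0 \<le> (grad_f xs - 0) \<bullet> (y - xs)"
    then have \<delta>: "0 < \<delta>" by (simp add: \<delta>_def)
    have "(\<lambda>k. grad_f (x k)) \<longlonglongrightarrow> grad_f xs"
      by (rule continuous_on_tendsto_compose[OF gradient_continuous lim]) auto
    then have "(\<lambda>k. - (grad_f (x k) \<bullet> (y - x k))) \<longlonglongrightarrow> \<delta>"
      unfolding \<delta>_def by (intro tendsto_intros lim)
    then have "\<forall>\<^sub>F k in sequentially. \<delta> / 2 < - (grad_f (x k) \<bullet> (y - x k))"
      using \<delta> by (intro order_tendstoD(1)) auto
    moreover have "\<forall>\<^sub>F k in sequentially. - (\<alpha>_lo * \<delta> / 4) < x k \<bullet> t k"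
      using xt \<delta> step_bounds by (intro order_tendstoD(1)) auto
    \<comment> \<open>The product of \<open>t k\<close> with \<open>y - x k\<close> is at least
      \<open>\<alpha>_lo * \<delta> / 2\<close>, and replacing \<open>y - x k\<close> by
      \<open>y\<close> loses at most half of this.\<close>
    ultimately have "\<forall>\<^sub>F k in sequentially. \<alpha>_lo * \<delta> / 4 \<le> t k \<bullet> y"
    proof eventually_elim
      case (elim k)
      have "\<alpha>_lo * (\<delta> / 2) \<le> \<alpha> k * (- (grad_f (x k) \<bullet> (y - x k)))"
        using elim steps[of k] step_bounds \<delta> by (intro mult_mono) auto
      also have "\<dots> = t k \<bullet> (y - x k)"
        using optimality[OF A_diff[OF y], of "x k" k] x_in by (simp add: inner_add_left)
      finally show ?case
        using elim by (simp add: inner_diff_right inner_commute)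
    qed
    then obtain N where N: "\<And>k. N \<le> k \<Longrightarrow> \<alpha>_lo * \<delta> / 4 \<le> t k \<bullet> y"
      unfolding eventually_sequentially by blast
    define S where "S k = (\<Sum>i\<in>UNIV. y $ i * ln (x k $ i))" for k
    have S_Suc: "S (Suc k) - S k = t k \<bullet> y" for k
      by (simp add: S_def inner_vec_def t_nth sum_subtractf[symmetric] algebra_simps)
    \<comment> \<open>Only an upper bound is sought: logarithms of entries tending to 0 may diverge
      downwards.\<close>
    have S_upper: "S k \<le> (\<Sum>i\<in>UNIV. y $ i * ln X)" for k
      unfolding S_def using y X x_pos[of k]
      by (intro sum_mono mult_left_mono) (auto simp: feasible_set_def nonneg_orthant_def)
    have grow: "S N + real m * (\<alpha>_lo * \<delta> / 4) \<le> S (N + m)" for m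
    proof (induction m)
      case (Suc m)
      then show ?case
        using N[of "N + m"] S_Suc[of "N + m"] by (simp add: field_simps)
    qed simp
    have "0 < \<alpha>_lo * \<delta> / 4" using \<delta> step_bounds by simp
    then obtain m where "(\<Sum>i\<in>UNIV. y $ i * ln X) - S N < real m * (\<alpha>_lo * \<delta> / 4)"
      using reals_Archimedean3 by blast
    with grow[of m] S_upper[of "N + m"] show False by simp
  qed
  then have "0 \<in> frechet_subdiff F xs"
    by (rule frechet_subdiff_penalizedI[OF gradient xs(1)])
  then show ?thesis
    using frechet_subset_limiting_subdiff by (auto simp: critical_point_def)
qed

section \<open>Rates of convergence\<close>

text \<open>For exponent 1/2 the derivative is \<open>c / (2 * sqrt s)\<close>, so the SKL
  inequality bounds the gap \<open>s\<close> by a multiple of \<open>(e k)\<^sup>2\<close>, hence by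
  a multiple of the decrease of \<open>f\<close>.\<close>

lemma eventual_contraction:
  assumes skl: "skl_at_exponent (1 / 2) F xs" and lim: "x \<longlonglongrightarrow> xs"
  obtains q N where "q < 1"
    "\<And>k. N \<le> k \<Longrightarrow> f (x (Suc k)) - f xs \<le> q * (f (x k) - f xs)"
proof -
  have id: "strict_mono (id :: nat \<Rightarrow> nat)" "(x \<circ> id) \<longlonglongrightarrow> xs"
    using lim by (simp_all add: strict_mono_def)
  note xs = cluster_value[OF id]
  obtain c where c: "0 < c" and skl': "skl_with (\<lambda>s. c * s powr (1 - 1 / 2)) F xs"
    using skl by (auto simp: skl_at_exponent_def)
  obtain \<eta> \<rho> N where \<rho>: "0 < \<rho>"
    and ineq: "\<And>k. N \<le> k \<Longrightarrow> x k \<in> ball xs \<rho> \<Longrightarrow> f xs < f (x k) \<Longrightarrow>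
      \<alpha> k \<le> deriv (\<lambda>s. c * s powr (1 - 1 / 2)) (f (x k) - f xs) * e k"
    using skl_along_iterates[OF skl' xs(1,3)] by metis
  obtain M where M: "\<And>k. M \<le> k \<Longrightarrow> x k \<in> ball xs \<rho>"
    using LIMSEQ_D[OF lim \<rho>] by (auto simp: dist_norm norm_minus_commute)
  obtain c1 where c1: "0 < c1" "\<And>k. c1 * (e k)\<^sup>2 \<le> f (x k) - f (x (Suc k))"
    using descent by blast
  \<comment> \<open>The square comes from squaring
    \<open>2 * \<alpha>_lo / c * sqrt s \<le> e k\<close>, the factor \<open>c1\<close> from
    \<open>descent\<close>.\<close>
  define \<kappa> where "\<kappa> = c1 * (2 * \<alpha>_lo / c)\<^sup>2"
  have "0 < \<kappa>" using c c1 step_bounds by (simp add: \<kappa>_def)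
  have "f (x (Suc k)) - f xs \<le> (1 - \<kappa>) * (f (x k) - f xs)" if k: "max N M \<le> k" for k
  proof (cases "f (x k) = f xs")
    case True
    then show ?thesis using e_eq_0_if_stationary(2)[OF xs(2) True] by simp
  next
    case False
    define s where "s = f (x k) - f xs"
    have s: "0 < s" using False xs(2)[of k] by (simp add: s_def)
    have "((\<lambda>s. c * s powr (1 - 1 / 2)) has_real_derivative c / (2 * sqrt s)) (at s)"
      using s by (auto intro!: derivative_eq_intros
          simp: powr_minus powr_half_sqrt field_simps)
    then have "deriv (\<lambda>s. c * s powr (1 - 1 / 2)) s = c / (2 * sqrt s)"
      by (rule DERIV_imp_deriv)
    then have "\<alpha>_lo \<le> c / (2 * sqrt s) * e k"
      using ineq[of k] M[of k] k s steps[of k] by (auto simp: s_def)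
    then have "2 * \<alpha>_lo / c * sqrt s \<le> e k"
      using s c by (simp add: field_simps)
    then have "(2 * \<alpha>_lo / c * sqrt s)\<^sup>2 \<le> (e k)\<^sup>2"
      using c s step_bounds by (intro power_mono) auto
    then have "(2 * \<alpha>_lo / c)\<^sup>2 * s \<le> (e k)\<^sup>2"
      unfolding power_mult_distrib[of _ "sqrt s"] using s by simp
    then have "\<kappa> * s \<le> c1 * (e k)\<^sup>2"
      using c1(1) by (simp add: \<kappa>_def mult.assoc)
    with c1(2)[of k] show ?thesis by (simp add: s_def algebra_simps)
  qed
  with \<open>0 < \<kappa>\<close> show thesis by (intro that[of "1 - \<kappa>" "max N M"]) auto
qed

text \<open>A gap of order \<open>p ^ k\<close> bounds \<open>(e k)\<^sup>2\<close>, so the steps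
  decay like \<open>sqrt p ^ k\<close>.\<close>

lemma iterates_R_linear:
  assumes lim: "x \<longlonglongrightarrow> xs" and q: "q < 1"
    and contr: "\<And>k. N \<le> k \<Longrightarrow> f (x (Suc k)) - f xs \<le> q * (f (x k) - f xs)"
  shows "R_linear x xs"
proof -
  have id: "strict_mono (id :: nat \<Rightarrow> nat)" "(x \<circ> id) \<longlonglongrightarrow> xs"
    using lim by (simp_all add: strict_mono_def)
  note xs = cluster_value[OF id]
  obtain c1 where c1: "0 < c1" "\<And>k. c1 * (e k)\<^sup>2 \<le> f (x k) - f (x (Suc k))"
    using descent by blast
  obtain c2 where c2: "0 < c2" "\<And>k. norm (x (Suc k) - x k) \<le> c2 * e k"
    using step_length by blast
  \<comment> \<open>A positive factor allows division by \<open>p ^ N\<close> and a positive rate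
    \<open>sqrt p\<close>.\<close>
  define p where "p = max q (1 / 2)"
  have p: "0 < p" "p < 1" "q \<le> p" using q by (auto simp: p_def)
  define R where "R = (f (x N) - f xs) / p ^ N"
  have "0 \<le> R" using p xs(2)[of N] by (simp add: R_def)
  have gap: "f (x k) - f xs \<le> R * p ^ k" if "N \<le> k" for k
    using that
  proof (induction k rule: dec_induct)
    case base
    then show ?case using p by (simp add: R_def)
  next
    case (step k)
    have "f (x (Suc k)) - f xs \<le> p * (f (x k) - f xs)"
      using contr[of k] step.hyps p xs(2)[of k] mult_right_mono[of q p "f (x k) - f xs"] by simp
    also have "\<dots> \<le> p * (R * p ^ k)"
      using step.IH p by (intro mult_left_mono) auto
    finally show ?case by (simp add: algebra_simps)
  qed
  have "norm (x (Suc k) - x k) \<le> c2 * sqrt (R / c1) * sqrt p ^ k" if k: "N \<le> k" for k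
  proof -
    have "c1 * (e k)\<^sup>2 \<le> R * p ^ k"
      using c1(2)[of k] gap[OF k] xs(2)[of "Suc k"] by simp
    then have "(e k)\<^sup>2 \<le> R / c1 * p ^ k"
      using c1(1) by (simp add: field_simps)
    then have "e k \<le> sqrt (R / c1 * p ^ k)" by (rule real_le_rsqrt)
    also have "\<dots> = sqrt (R / c1) * sqrt p ^ k"
      by (simp only: real_sqrt_mult real_sqrt_power)
    finally have "c2 * e k \<le> c2 * (sqrt (R / c1) * sqrt p ^ k)"
      using c2(1) by (intro mult_left_mono) auto
    with c2(2)[of k] show ?thesis by simp
  qed
  then show ?thesis
    using p c1(1) c2(1) \<open>0 \<le> R\<close>
    by (intro R_linear_if_geometric_steps[OF lim, of "sqrt p" "c2 * sqrt (R / c1)" N]) auto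
qed

lemma linear_convergence:
  assumes skl: "skl_function_exponent (1 / 2) F"
  shows "\<exists>xs. critical_point F xs \<and> R_linear x xs \<and>
           Q_linear (\<lambda>k. real_of_ereal (F (x k))) (real_of_ereal (F xs))"
proof -
  obtain xs where lim: "x \<longlonglongrightarrow> xs"
    using iterates_convergent skl by (auto simp: skl_function_exponent_def)
  have id: "strict_mono (id :: nat \<Rightarrow> nat)" "(x \<circ> id) \<longlonglongrightarrow> xs"
    using lim by (simp_all add: strict_mono_def)
  note xs = cluster_value[OF id]
  have crit: "critical_point F xs" by (rule limit_critical[OF lim])
  then have "skl_at_exponent (1 / 2) F xs"
    using skl by (simp add: skl_function_exponent_def orthant_extension_penalized)
  then obtain q N where q: "q < 1"
    and contr: "\<And>k. N \<le> k \<Longrightarrow> f (x (Suc k)) - f xs \<le> q * (f (x k) - f xs)"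
    using eventual_contraction[OF _ lim] by metis
  have "R_linear x xs" by (rule iterates_R_linear[OF lim q contr])
  moreover have "Q_linear (\<lambda>k. f (x k)) (f xs)"
    by (rule Q_linear_if_contraction[where w = "\<lambda>k. f (x k)", OF q xs(2) contr])
  ultimately show ?thesis
    using crit x_in xs(1) by (auto simp: penalized_eq)
qed

end


theorem theorem2:
  fixes A :: "real ^ 'n ^ 'm" and b :: "real ^ 'm"
    and f :: "real ^ 'n \<Rightarrow> real" and grad_f :: "real ^ 'n \<Rightarrow> real ^ 'n"
    and L \<alpha>_lo \<alpha>_hi :: real and \<alpha> :: "nat \<Rightarrow> real" and x :: "nat \<Rightarrow> real ^ 'n"
  defines "D \<equiv> feasible_set A b"
  defines "F \<equiv> penalized f D"
  assumes full_row_rank: "rank A = CARD('m)"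
    and strictly_feasible: "D \<inter> pos_orthant \<noteq> {}"
    and gradient: "\<And>y. GDERIV f y :> grad_f y"
    and gradient_continuous: "continuous_on UNIV grad_f"
    and L_pos: "0 < L"
    and rel_smooth: "relatively_smooth_on D L shannon f"
    and optimal_solution: "\<exists>y\<in>D. \<forall>z\<in>D. f y \<le> f z"
    and step_bounds: "0 < \<alpha>_lo" "\<alpha>_lo < \<alpha>_hi" "\<alpha>_hi < 1 / L"
    and steps: "\<And>k. \<alpha> k \<in> {\<alpha>_lo..\<alpha>_hi}"
    and bpgm: "bpgm_sequence D f grad_f \<alpha> x"
    and skl: "skl_function_exponent (1 / 2) F"
    and bounded: "bounded (range x)"
  shows "\<exists>xs. critical_point F xs \<and> R_linear x xs \<and>
              Q_linear (\<lambda>k. real_of_ereal (F (x k))) (real_of_ereal (F xs))"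
proof -
  interpret entropic_bpgm A b f grad_f L \<alpha>_lo \<alpha>_hi \<alpha> x
    using gradient gradient_continuous L_pos rel_smooth step_bounds steps bpgm bounded
    unfolding D_def by unfold_locales
  show ?thesis
    using linear_convergence skl unfolding F_def D_def by blast
qed

end
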